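(* For each $\mathcal C^{r+1}$ Anosov flow $T_t$ on a compact Riemannian manifold $\mathcal M$ there exist a $\mathcal C^r$ Riemannian metric $\|\cdot\|_1$, uniformly equivalent to the original Riemannian metric, invariant unstable and stable conefields $C^u(x)$, $C^s(x)$, and $\sigma>0$ such that $$\|D_xT_tv\|_1\ge e^{\sigma t}\|v\|_1\quad\text{for all } t\ge0,\ v\in C^u(x),$$ $$\|D_xT_{-t}v\|_1\ge e^{\sigma t}\|v\|_1\quad\text{for all } t\ge0,\ v\in C^s(x),$$ for every $x\in\mathcal M$.
   Context: Anosov flow: at each $x\in\mathcal M$ there is a splitting $T_x\mathcal M=E^s(x)\oplus E^f(x)\oplus E^u(x)$, continuous in $x$ and invariant with respect to $T_t$, where $E^f$ is one dimensional and coincides with the flow direction, and there exist $C,\lambda>0$ such that $\|DT_tv\|\le Ce^{-\lambda t}\|v\|$ for $v\in E^s$, $t\ge0$; $\|DT_{-t}v\|\le Ce^{-\lambda t}\|v\|$ for $v\in E^u$, $t\ge 0$; and $C^{-1}\|v\|\le\|DT_tv\|\le C\|v\|$ for $v\in E^f$, $t\in\mathbb R$. Invariant unstable and stable conefields are meant in the usual sense of hyperbolic theory: families of cones $C^u(x),C^s(x)\subset T_x\mathcal M$ that are neighbourhoods of $E^u(x)\setminus\{0\}$ and $E^s(x)\setminus\{0\}$ respectively, with $C^u(x)\cap(E^s(x)\oplus E^f(x))\subset\{0\}$ and $C^s(x)\cap(E^u(x)\oplus E^f(x))\subset\{0\}$, and such that $D_xT_tC^u(x)\subset C^u(T_tx)$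 and $D_xT_{-t}C^s(x)\subset C^s(T_{-t}x)$ for all $t\ge0$. $\|\cdot\|_1$ uniformly equivalent to $\|\cdot\|$ means there is a constant $c\geq 1$ with $c^{-1}\|v\|\le\|v\|_1\le c\|v\|$ for all tangent vectors $v$. *)

theory Defs
  imports "HOL-Analysis.Analysis" "HOL-Library.Extended_Nat"
begin

section \<open>Maps of class C^k on open sets of Euclidean spaces\<close>

primrec Cn_on :: "nat \<Rightarrow> ('b::euclidean_space \<Rightarrow> 'c::real_normed_vector) \<Rightarrow> 'b set \<Rightarrow> bool" where
  "Cn_on 0 f U \<longleftrightarrow> continuous_on U f"
| "Cn_on (Suc n) f U \<longleftrightarrow>
     (\<forall>x\<in>U. f differentiable (at x)) \<and> (\<forall>v. Cn_on n (\<lambda>x. frechet_derivative f (at x) v) U)"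

definition Ck_on :: "enat \<Rightarrow> ('b::euclidean_space \<Rightarrow> 'c::real_normed_vector) \<Rightarrow> 'b set \<Rightarrow> bool" where
  "Ck_on k f U \<longleftrightarrow> (\<forall>n. enat n \<le> k \<longrightarrow> Cn_on n f U)"


section \<open>Smooth manifolds\<close>

text \<open>The model space is \<^typ>\<open>'b::euclidean_space\<close>, so the dimension is \<open>DIM('b)\<close>.
  A chart is a pair of a domain and a coordinate map, the latter being relevant on the domain only.\<close>

type_synonym ('a, 'b) chart = "'a set \<times> ('a \<Rightarrow> 'b)"

abbreviation cdom :: "('a, 'b) chart \<Rightarrow> 'a set" where "cdom c \<equiv> fst c"
abbreviation cmap :: "('a, 'b) chart \<Rightarrow> 'a \<Rightarrow> 'b" where "cmap c \<equiv> snd c"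
definition cimg :: "('a, 'b) chart \<Rightarrow> 'b set" where "cimg c = cmap c ` cdom c"
definition cinv :: "('a, 'b) chart \<Rightarrow> 'b \<Rightarrow> 'a" where "cinv c = inv_into (cdom c) (cmap c)"

definition smooth_manifold :: "'a topology \<Rightarrow> ('a, 'b::euclidean_space) chart set \<Rightarrow> bool" where
  "smooth_manifold X A \<longleftrightarrow>
     Hausdorff_space X \<and> second_countable X \<and>
     topspace X = (\<Union>c\<in>A. cdom c) \<and>
     (\<forall>c\<in>A. openin X (cdom c) \<and> open (cimg c) \<and>
        homeomorphic_map (subtopology X (cdom c)) (top_of_set (cimg c)) (cmap c)) \<and>
     (\<forall>c\<in>A. \<forall>d\<in>A. Ck_on \<infinity> (cmap d \<circ> cinv c) (cmap c ` (cdom c \<inter> cdom d)))"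


section \<open>Tangent vectors\<close>

text \<open>A tangent vector at \<open>x\<close> is an equivalence class of pairs of a chart \<open>c\<close> around \<open>x\<close> and a
  coordinate vector, where \<open>(c, v) \<sim> (d, D(d \<circ> c\<inverse>) v)\<close>. Each class has exactly one
  representative whose chart is a selected one, \<open>chart_at A x\<close>, and we represent the class by the
  coordinate vector of this representative. Thus each tangent space is carried by \<^typ>\<open>'b\<close>, with
  its vector space structure and topology. The choice of charts is not continuous in \<open>x\<close>;
  regularity of objects on the tangent bundle is therefore always
  expressed through coordinates with respect to a fixed chart: \<open>to_coord A c x v\<close> are the
  coordinates in \<open>c\<close> of the tangent vector \<open>v\<close> at \<open>x\<close>, and \<open>of_coord A c x\<close> is the inverse of
  \<open>to_coord A c x\<close>.\<close>

definition chart_at :: "('a, 'b) chart set \<Rightarrow> 'a \<Rightarrow> ('a, 'b) chart" where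
  "chart_at A x = (SOME c. c \<in> A \<and> x \<in> cdom c)"

definition to_coord :: "('a, 'b::euclidean_space) chart set \<Rightarrow> ('a, 'b) chart \<Rightarrow> 'a \<Rightarrow> 'b \<Rightarrow> 'b" where
  "to_coord A c x =
     frechet_derivative (cmap c \<circ> cinv (chart_at A x)) (at (cmap (chart_at A x) x))"

definition of_coord :: "('a, 'b::euclidean_space) chart set \<Rightarrow> ('a, 'b) chart \<Rightarrow> 'a \<Rightarrow> 'b \<Rightarrow> 'b" where
  "of_coord A c x = frechet_derivative (cmap (chart_at A x) \<circ> cinv c) (at (cmap c x))"

definition tangent_map ::
  "('a, 'b::euclidean_space) chart set \<Rightarrow> ('a \<Rightarrow> 'a) \<Rightarrow> 'a \<Rightarrow> 'b \<Rightarrow> 'b" where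
  "tangent_map A f x =
     frechet_derivative (cmap (chart_at A (f x)) \<circ> f \<circ> cinv (chart_at A x))
       (at (cmap (chart_at A x) x))"

definition continuous_vector_field_on ::
  "('a, 'b::euclidean_space) chart set \<Rightarrow> 'a set \<Rightarrow> ('a \<Rightarrow> 'b) \<Rightarrow> bool" where
  "continuous_vector_field_on A W V \<longleftrightarrow>
     (\<forall>c\<in>A. continuous_on (cmap c ` (cdom c \<inter> W))
        (\<lambda>p. to_coord A c (cinv c p) (V (cinv c p))))"

text \<open>A field of subspaces is continuous if it has continuous local frames.\<close>

definition continuous_distribution ::
  "'a topology \<Rightarrow> ('a, 'b::euclidean_space) chart set \<Rightarrow> ('a \<Rightarrow> 'b set) \<Rightarrow> bool" where
  "continuous_distribution X A E \<longleftrightarrow>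
     (\<forall>x\<in>topspace X. \<exists>W k. \<exists>V :: nat \<Rightarrow> 'a \<Rightarrow> 'b. openin X W \<and> x \<in> W \<and>
        (\<forall>i<k. continuous_vector_field_on A W (V i)) \<and>
        (\<forall>y\<in>W. inj_on (\<lambda>i. V i y) {..<k} \<and> independent ((\<lambda>i. V i y) ` {..<k}) \<and>
           span ((\<lambda>i. V i y) ` {..<k}) = E y))"


section \<open>Riemannian metrics\<close>

definition riemannian_metric ::
  "'a topology \<Rightarrow> ('a, 'b::euclidean_space) chart set \<Rightarrow> enat \<Rightarrow> ('a \<Rightarrow> 'b \<Rightarrow> 'b \<Rightarrow> real) \<Rightarrow> bool" where
  "riemannian_metric X A k g \<longleftrightarrow>
     (\<forall>x\<in>topspace X. bilinear (g x) \<and> (\<forall>v w. g x v w = g x w v) \<and>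
        (\<forall>v. v \<noteq> 0 \<longrightarrow> g x v v > 0)) \<and>
     (\<forall>c\<in>A. \<forall>v w.
        Ck_on k (\<lambda>p. g (cinv c p) (of_coord A c (cinv c p) v) (of_coord A c (cinv c p) w)) (cimg c))"

definition metric_norm :: "('a \<Rightarrow> 'b \<Rightarrow> 'b \<Rightarrow> real) \<Rightarrow> 'a \<Rightarrow> 'b \<Rightarrow> real" where
  "metric_norm g x v = sqrt (g x v v)"

definition uniformly_equivalent_metrics ::
  "'a topology \<Rightarrow> ('a \<Rightarrow> 'b \<Rightarrow> 'b \<Rightarrow> real) \<Rightarrow> ('a \<Rightarrow> 'b \<Rightarrow> 'b \<Rightarrow> real) \<Rightarrow> bool" where
  "uniformly_equivalent_metrics X g h \<longleftrightarrow>
     (\<exists>c\<ge>1. \<forall>x\<in>topspace X. \<forall>v.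
        inverse c * metric_norm g x v \<le> metric_norm h x v \<and>
        metric_norm h x v \<le> c * metric_norm g x v)"

definition compact_riemannian_manifold ::
  "'a topology \<Rightarrow> ('a, 'b::euclidean_space) chart set \<Rightarrow> ('a \<Rightarrow> 'b \<Rightarrow> 'b \<Rightarrow> real) \<Rightarrow> bool" where
  "compact_riemannian_manifold X A g \<longleftrightarrow>
     smooth_manifold X A \<and> compact_space X \<and> riemannian_metric X A \<infinity> g"


section \<open>Anosov flows\<close>

text \<open>A flow is of class C^k if it is so jointly in time and space.\<close>

definition Ck_flow ::
  "'a topology \<Rightarrow> ('a, 'b::euclidean_space) chart set \<Rightarrow> enat \<Rightarrow> (real \<Rightarrow> 'a \<Rightarrow> 'a) \<Rightarrow> bool" where
  "Ck_flow X A k T \<longleftrightarrow>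
     (\<forall>x\<in>topspace X. T 0 x = x \<and>
        (\<forall>t. T t x \<in> topspace X) \<and> (\<forall>s t. T (s + t) x = T s (T t x))) \<and>
     (\<forall>c\<in>A. \<forall>d\<in>A. let W = {(t, p). p \<in> cimg c \<and> T t (cinv c p) \<in> cdom d} in
        open W \<and> Ck_on k (\<lambda>(t, p). cmap d (T t (cinv c p))) W)"

definition flow_direction ::
  "('a, 'b::euclidean_space) chart set \<Rightarrow> (real \<Rightarrow> 'a \<Rightarrow> 'a) \<Rightarrow> 'a \<Rightarrow> 'b" where
  "flow_direction A T x = vector_derivative (\<lambda>t. cmap (chart_at A x) (T t x)) (at 0)"

definition direct_sum3 :: "'b::real_vector set \<Rightarrow> 'b set \<Rightarrow> 'b set \<Rightarrow> bool" where
  "direct_sum3 P Q R \<longleftrightarrow> subspace P \<and> subspace Q \<and> subspace R \<and>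
     (\<forall>v. \<exists>a\<in>P. \<exists>b\<in>Q. \<exists>c\<in>R. v = a + b + c) \<and>
     (\<forall>a\<in>P. \<forall>b\<in>Q. \<forall>c\<in>R. a + b + c = 0 \<longrightarrow> a = 0 \<and> b = 0 \<and> c = 0)"

definition invariant_distribution ::
  "'a topology \<Rightarrow> ('a, 'b::euclidean_space) chart set \<Rightarrow> (real \<Rightarrow> 'a \<Rightarrow> 'a) \<Rightarrow> ('a \<Rightarrow> 'b set) \<Rightarrow> bool" where
  "invariant_distribution X A T E \<longleftrightarrow>
     (\<forall>x\<in>topspace X. \<forall>t. tangent_map A (T t) x ` E x = E (T t x))"

definition anosov_flow ::
  "'a topology \<Rightarrow> ('a, 'b::euclidean_space) chart set \<Rightarrow> ('a \<Rightarrow> 'b \<Rightarrow> 'b \<Rightarrow> real) \<Rightarrow> enat \<Rightarrow>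
   (real \<Rightarrow> 'a \<Rightarrow> 'a) \<Rightarrow> ('a \<Rightarrow> 'b set) \<Rightarrow> ('a \<Rightarrow> 'b set) \<Rightarrow> ('a \<Rightarrow> 'b set) \<Rightarrow> bool" where
  "anosov_flow X A g k T Es Ef Eu \<longleftrightarrow>
     Ck_flow X A k T \<and>
     (\<forall>x\<in>topspace X. direct_sum3 (Es x) (Ef x) (Eu x)) \<and>
     (\<forall>E\<in>{Es, Ef, Eu}. continuous_distribution X A E \<and> invariant_distribution X A T E) \<and>
     (\<forall>x\<in>topspace X. dim (Ef x) = 1 \<and> Ef x = span {flow_direction A T x}) \<and>
     (\<exists>C>0. \<exists>\<kappa>>0. \<forall>x\<in>topspace X.
        (\<forall>v\<in>Es x. \<forall>t\<ge>0. metric_norm g (T t x) (tangent_map A (T t) x v)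
           \<le> C * exp (- \<kappa> * t) * metric_norm g x v) \<and>
        (\<forall>v\<in>Eu x. \<forall>t\<ge>0. metric_norm g (T (- t) x) (tangent_map A (T (- t)) x v)
           \<le> C * exp (- \<kappa> * t) * metric_norm g x v) \<and>
        (\<forall>v\<in>Ef x. \<forall>t. inverse C * metric_norm g x v
             \<le> metric_norm g (T t x) (tangent_map A (T t) x v) \<and>
           metric_norm g (T t x) (tangent_map A (T t) x v) \<le> C * metric_norm g x v))"


section \<open>Conefields\<close>

text \<open>A conefield around \<open>E\<close> that is transverse to \<open>F\<close>. The library's \<^const>\<open>cone\<close> only gives
  invariance under nonnegative scaling; cones here are symmetric.\<close>

definition conefield ::
  "'a topology \<Rightarrow> ('a \<Rightarrow> 'b::euclidean_space set) \<Rightarrow> ('a \<Rightarrow> 'b set) \<Rightarrow> ('a \<Rightarrow> 'b set) \<Rightarrow> bool" where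
  "conefield X E F K \<longleftrightarrow>
     (\<forall>x\<in>topspace X. 0 \<in> K x \<and> cone (K x) \<and> (\<forall>v\<in>K x. - v \<in> K x) \<and>
        E x - {0} \<subseteq> interior (K x) \<and> K x \<inter> F x \<subseteq> {0})"

definition invariant_unstable_conefield ::
  "'a topology \<Rightarrow> ('a, 'b::euclidean_space) chart set \<Rightarrow> (real \<Rightarrow> 'a \<Rightarrow> 'a) \<Rightarrow>
   ('a \<Rightarrow> 'b set) \<Rightarrow> ('a \<Rightarrow> 'b set) \<Rightarrow> ('a \<Rightarrow> 'b set) \<Rightarrow> ('a \<Rightarrow> 'b set) \<Rightarrow> bool" where
  "invariant_unstable_conefield X A T Es Ef Eu Cu \<longleftrightarrow>
     conefield X Eu (\<lambda>x. {a + b |a b. a \<in> Es x \<and> b \<in> Ef x}) Cu \<and>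
     (\<forall>x\<in>topspace X. \<forall>t\<ge>0. tangent_map A (T t) x ` Cu x \<subseteq> Cu (T t x))"

definition invariant_stable_conefield ::
  "'a topology \<Rightarrow> ('a, 'b::euclidean_space) chart set \<Rightarrow> (real \<Rightarrow> 'a \<Rightarrow> 'a) \<Rightarrow>
   ('a \<Rightarrow> 'b set) \<Rightarrow> ('a \<Rightarrow> 'b set) \<Rightarrow> ('a \<Rightarrow> 'b set) \<Rightarrow> ('a \<Rightarrow> 'b set) \<Rightarrow> bool" where
  "invariant_stable_conefield X A T Es Ef Eu Cs \<longleftrightarrow>
     conefield X Es (\<lambda>x. {a + b |a b. a \<in> Eu x \<and> b \<in> Ef x}) Cs \<and>
     (\<forall>x\<in>topspace X. \<forall>t\<ge>0. tangent_map A (T (- t)) x ` Cs x \<subseteq> Cs (T (- t) x))"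

end

theory Submission
  imports Defs
begin

text \<open>Average the metric over a long time window:
  \<open>g\<^sub>1(v, v) = \<integral>\<^bsub>-L\<^esub>\<^bsup>L\<^esup> \<parallel>DT\<^sub>t v\<parallel>\<^sup>2 dt\<close>. This is as smooth as \<open>DT\<^sub>t\<close>, so no smoothing is needed,
  and its derivative along the flow is the boundary term \<open>\<parallel>DT\<^sub>L v\<parallel>\<^sup>2 - \<parallel>DT\<^bsub>-L\<^esub> v\<parallel>\<^sup>2\<close>. For \<open>L\<close> large this
  is at least \<open>2 \<sigma> g\<^sub>1(v, v)\<close> on \<open>E\<^sup>u\<close>, hence also near \<open>E\<^sup>u\<close>, and by time reversal the same \<open>g\<^sub>1\<close> serves
  \<open>E\<^sup>s\<close>. As unstable cone take all vectors whose forward orbit expands at rate \<open>\<sigma>\<close> between any two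
  times: invariance and expansion are then automatic, transversality holds because orbits in
  \<open>E\<^sup>s \<oplus> E\<^sup>f\<close> stay bounded, and the cone is a neighbourhood of \<open>E\<^sup>u - {0}\<close> because the
  \<open>E\<^sup>s \<oplus> E\<^sup>f\<close> component stays small relative to the \<open>E\<^sup>u\<close> component. All uniform constants come
  from comparing two continuous Riemannian metrics on a compact manifold, one of them being the
  pullback by \<open>T\<^bsub>\<plusminus>L\<^esub>\<close>.\<close>


section \<open>Calculus of maps of class C^k\<close>

lemma Cn_on_cong:
  assumes "open U" "\<And>x. x \<in> U \<Longrightarrow> f x = g x" "Cn_on n f U"
  shows "Cn_on n g U"
  using assms(2,3)
proof (induction n arbitrary: f g)
  case 0
  then show ?case by (simp cong: continuous_on_cong)
next
  case (Suc n)
  have der: "(g has_derivative frechet_derivative f (at x)) (at x)" if "x \<in> U" for x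
    using has_derivative_transform_within_open[OF _ \<open>open U\<close> that Suc.prems(1)]
      Suc.prems(2) that by (simp add: frechet_derivative_works)
  have "frechet_derivative f (at x) = frechet_derivative g (at x)" if "x \<in> U" for x
    using frechet_derivative_at[OF der[OF that]] .
  then have "Cn_on n (\<lambda>x. frechet_derivative g (at x) v) U" for v
    using Suc.IH[of "\<lambda>x. frechet_derivative f (at x) v"] Suc.prems(2) by simp
  then show ?case
    using der by (auto simp: differentiable_def)
qed

text \<open>The closure rules below exhibit explicit derivatives; uniqueness of the derivative
  identifies these with \<open>frechet_derivative\<close>, in terms of which \<open>Cn_on\<close> is
  defined.\<close>

lemma Cn_on_SucI:
  assumes "open U" "\<And>x. x \<in> U \<Longrightarrow> (f has_derivative f' x) (at x)"
    "\<And>v. Cn_on n (\<lambda>x. f' x v) U"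
  shows "Cn_on (Suc n) f U"
proof -
  have "f' x = frechet_derivative f (at x)" if "x \<in> U" for x
    using frechet_derivative_at[OF assms(2)[OF that]] .
  then have "Cn_on n (\<lambda>x. frechet_derivative f (at x) v) U" for v
    using Cn_on_cong[OF assms(1) _ assms(3)[of v]] by simp
  then show ?thesis
    using assms(2) by (auto simp: differentiable_def)
qed

lemma Cn_on_Suc_has_derivative:
  "Cn_on (Suc n) f U \<Longrightarrow> x \<in> U \<Longrightarrow> (f has_derivative frechet_derivative f (at x)) (at x)"
  by (simp add: frechet_derivative_works)

text \<open>Continuity and differentiability are tested at single points, and the derivative
  inherits the local hypothesis. This permits a different target chart near each point when the flow
  is read in coordinates.\<close>

lemma Cn_on_local:
  assumes "\<And>x. x \<in> U \<Longrightarrow> \<exists>W. open W \<and> x \<in> W \<and> Cn_on n f W"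
  shows "Cn_on n f U"
  using assms
proof (induction n arbitrary: f)
  case 0
  then show ?case
    by (auto intro!: continuous_at_imp_continuous_on simp: continuous_on_eq_continuous_at)
      (metis continuous_on_eq_continuous_at)
next
  case (Suc n)
  show ?case
    unfolding Cn_on.simps
  proof (intro conjI ballI allI)
    fix x assume "x \<in> U"
    with Suc.prems show "f differentiable (at x)" by fastforce
  next
    fix v
    show "Cn_on n (\<lambda>x. frechet_derivative f (at x) v) U"
      using Suc.prems by (intro Suc.IH) fastforce
  qed
qed

lemma Cn_on_Suc_imp: "Cn_on (Suc n) f U \<Longrightarrow> Cn_on n f U"
proof (induction n arbitrary: f)
  case 0
  then show ?case
    by (auto intro!: continuous_at_imp_continuous_on differentiable_imp_continuous_within)
next
  case (Suc n)
  then show ?case by (metis Cn_on.simps(2))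
qed

lemma Cn_on_le: "m \<le> n \<Longrightarrow> Cn_on n f U \<Longrightarrow> Cn_on m f U"
  by (induction n) (auto simp: le_Suc_eq simp del: Cn_on.simps(2) dest: Cn_on_Suc_imp)

lemma Cn_on_const: "open U \<Longrightarrow> Cn_on n (\<lambda>_. c) U"
  by (induction n arbitrary: c) (auto simp del: Cn_on.simps(2) intro!: Cn_on_SucI[where f'="\<lambda>_ _. 0"])

lemma Cn_on_bounded_linear:
  assumes "open U" "bounded_linear f"
  shows "Cn_on n f U"
proof (cases n)
  case 0
  then show ?thesis using assms by (simp add: linear_continuous_on)
next
  case (Suc m)
  show ?thesis
    unfolding Suc using assms
    by (intro Cn_on_SucI[where f'="\<lambda>_. f"] Cn_on_const bounded_linear_imp_has_derivative)
qed

lemma Cn_on_add: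
  assumes "open U" "Cn_on n f U" "Cn_on n g U"
  shows "Cn_on n (\<lambda>x. f x + g x) U"
  using assms(2,3)
proof (induction n arbitrary: f g)
  case 0
  then show ?case by (simp add: continuous_on_add)
next
  case (Suc n)
  show ?case
  proof (rule Cn_on_SucI[OF assms(1)])
    show "((\<lambda>x. f x + g x) has_derivative
        (\<lambda>v. frechet_derivative f (at x) v + frechet_derivative g (at x) v)) (at x)"
      if "x \<in> U" for x
      using Suc.prems that by (intro has_derivative_add Cn_on_Suc_has_derivative)
    show "Cn_on n (\<lambda>x. frechet_derivative f (at x) v + frechet_derivative g (at x) v) U" for v
      using Suc.prems by (intro Suc.IH) auto
  qed
qed

lemma Cn_on_sum:
  assumes "open U" "\<And>i. i \<in> I \<Longrightarrow> Cn_on n (f i) U"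
  shows "Cn_on n (\<lambda>x. \<Sum>i\<in>I. f i x) U"
  using assms(2)
  by (induction I rule: infinite_finite_induct) (auto simp: assms(1) Cn_on_const Cn_on_add)

text \<open>By the Leibniz rule the derivative is a sum of two products with one factor
  differentiated; the other factor is lowered by one order to fit the induction hypothesis.\<close>

lemma (in bounded_bilinear) Cn_on_prod:
  assumes "open U" "Cn_on n f U" "Cn_on n g U"
  shows "Cn_on n (\<lambda>x. prod (f x) (g x)) U"
  using assms(2,3)
proof (induction n arbitrary: f g)
  case 0
  then show ?case by (simp add: continuous_on)
next
  case (Suc n)
  show ?case
  proof (rule Cn_on_SucI[OF assms(1)])
    show "((\<lambda>x. prod (f x) (g x)) has_derivative
        (\<lambda>v. prod (f x) (frechet_derivative g (at x) v) + prod (frechet_derivative f (at x) v) (g x)))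
        (at x)"
      if "x \<in> U" for x
      using Suc.prems that by (intro FDERIV Cn_on_Suc_has_derivative)
    show "Cn_on n (\<lambda>x. prod (f x) (frechet_derivative g (at x) v) +
        prod (frechet_derivative f (at x) v) (g x)) U" for v
      using Suc.prems Cn_on_Suc_imp[of n f] Cn_on_Suc_imp[of n g]
      by (intro Cn_on_add Suc.IH assms(1)) auto
  qed
qed

lemmas Cn_on_scaleR = bounded_bilinear.Cn_on_prod[OF bounded_bilinear_scaleR]
lemmas Cn_on_mult = bounded_bilinear.Cn_on_prod[OF bounded_bilinear_mult]
lemmas Cn_on_inner = bounded_bilinear.Cn_on_prod[OF bounded_bilinear_inner]

text \<open>In the chain rule the derivative of \<open>g\<close> is applied to a vector that varies
  with \<open>x\<close>, whereas \<open>Cn_on\<close> controls derivatives along fixed vectors.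
  Expanding the varying vector in the basis leaves a finite sum of products of functions already
  known to be regular.\<close>

lemma Cn_on_compose:
  fixes f :: "'b::euclidean_space \<Rightarrow> 'c::euclidean_space" and g :: "'c \<Rightarrow> 'd::real_normed_vector"
  assumes "open U" "Cn_on n f U" "Cn_on n g V" "f ` U \<subseteq> V"
  shows "Cn_on n (\<lambda>x. g (f x)) U"
  using assms(2,3)
proof (induction n arbitrary: g)
  case 0
  then show ?case using assms(4) by (auto intro: continuous_on_compose2)
next
  case (Suc n)
  show ?case
  proof (rule Cn_on_SucI[OF assms(1)])
    fix x assume x: "x \<in> U"
    have g: "(g has_derivative frechet_derivative g (at (f x))) (at (f x))"
      by (rule Cn_on_Suc_has_derivative[OF Suc.prems(2)]) (use assms(4) x in auto)
    have der: "((\<lambda>x. g (f x)) has_derivative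
        (\<lambda>v. frechet_derivative g (at (f x)) (frechet_derivative f (at x) v))) (at x)"
      by (rule has_derivative_compose[OF Cn_on_Suc_has_derivative[OF Suc.prems(1) x] g])
    have "frechet_derivative g (at (f x)) u =
        (\<Sum>b\<in>Basis. (u \<bullet> b) *\<^sub>R frechet_derivative g (at (f x)) b)" for u
      using linear_sum[OF has_derivative_linear[OF g], of "\<lambda>b. (u \<bullet> b) *\<^sub>R b" Basis]
      by (simp add: euclidean_representation linear_scale[OF has_derivative_linear[OF g]])
    from has_derivative_eq_rhs[OF der ext[OF this]]
    show "((\<lambda>x. g (f x)) has_derivative
        (\<lambda>v. \<Sum>b\<in>Basis. (frechet_derivative f (at x) v \<bullet> b) *\<^sub>R frechet_derivative g (at (f x)) b)) (at x)" .
  next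
    fix v
    have "Cn_on n (\<lambda>x. frechet_derivative g (at (f x)) b) U" for b
      by (rule Suc.IH[OF Cn_on_Suc_imp[OF Suc.prems(1)], of "\<lambda>y. frechet_derivative g (at y) b"])
        (use Suc.prems(2) in simp)
    moreover have "Cn_on n (\<lambda>x. frechet_derivative f (at x) v) U"
      using Suc.prems(1) by simp
    ultimately show "Cn_on n (\<lambda>x. \<Sum>b\<in>Basis. (frechet_derivative f (at x) v \<bullet> b) *\<^sub>R frechet_derivative g (at (f x)) b) U"
      using assms(1) by (intro Cn_on_sum Cn_on_scaleR Cn_on_inner Cn_on_const)
  qed
qed

section \<open>Integrals over time that depend on a point in space\<close>

lemma has_derivative_Pair_slice:
  assumes "(h has_derivative h') (at (t, p))"
  shows "((\<lambda>p. h (t, p)) has_derivative (\<lambda>v. h' (0, v))) (at p)"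
  by (rule has_derivative_compose[of "\<lambda>p. (t, p)" "\<lambda>v. (0, v)" _ _ h, OF _ assms])
    (auto intro!: derivative_eq_intros)

lemma continuous_on_integral_param:
  fixes h :: "real \<times> 'b::euclidean_space \<Rightarrow> real"
  assumes "open U" "continuous_on (UNIV \<times> U) h"
  shows "continuous_on U (\<lambda>p. integral {a..b} (\<lambda>t. h (t, p)))"
proof -
  have "continuous_on (U \<times> cbox a b) (\<lambda>(p, t). h (t, p))"
    using assms(2) unfolding case_prod_beta
    by (intro continuous_on_compose2[OF assms(2)] continuous_intros) auto
  from integral_continuous_on_param[OF this] show ?thesis by simp
qed

text \<open>Differentiation under the integral sign needs the space derivative as a bounded linear
  map that depends continuously on point and time. In finite dimension this continuity may be tested
  on one vector at a time.\<close>

lemma has_derivative_integral_param: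
  fixes h :: "real \<times> 'b::euclidean_space \<Rightarrow> real"
  assumes "open U" "Cn_on 1 h (UNIV \<times> U)" "p \<in> U"
  shows "((\<lambda>p. integral {a..b} (\<lambda>t. h (t, p))) has_derivative
    (\<lambda>v. integral {a..b} (\<lambda>t. frechet_derivative h (at (t, p)) (0, v)))) (at p)"
proof -
  have der: "(h has_derivative frechet_derivative h (at (t, q))) (at (t, q))" if "q \<in> U" for t q
    using assms(2) that by (auto intro: Cn_on_Suc_has_derivative[of 0 h "UNIV \<times> U"])
  \<comment> \<open>\<open>Blinfun\<close> is meaningful only for bounded linear arguments, which is
    guaranteed for \<open>q\<close> in \<open>U\<close>.\<close>
  define h' where "h' q t = Blinfun (\<lambda>v. frechet_derivative h (at (t, q)) (0, v))" for q t
  have h': "blinfun_apply (h' q t) = (\<lambda>v. frechet_derivative h (at (t, q)) (0, v))"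
    if "q \<in> U" for q t
    unfolding h'_def
    by (rule bounded_linear_Blinfun_apply, rule has_derivative_bounded_linear)
      (rule has_derivative_Pair_slice[OF der[OF that]])
  have cont: "continuous_on (U \<times> cbox a b) (\<lambda>(q, t). h' q t)"
  proof (rule continuous_on_blinfun_componentwise)
    fix i :: 'b
    have *: "continuous_on (UNIV \<times> U) (\<lambda>x. frechet_derivative h (at x) (0, i))"
      using assms(2) by simp
    have "continuous_on (U \<times> cbox a b) (\<lambda>(q, t). frechet_derivative h (at (t, q)) (0, i))"
      unfolding case_prod_beta
      by (intro continuous_on_compose2[OF *] continuous_intros) auto
    then show "continuous_on (U \<times> cbox a b) (\<lambda>x. blinfun_apply (case x of (q, t) \<Rightarrow> h' q t) i)"
      by (rule continuous_on_eq) (auto simp: h')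
  qed
  \<comment> \<open>\<open>leibniz_rule\<close> asks for a convex domain, so the derivative is first
    taken within a ball; as the ball is open, this is the full derivative at
    \<open>p\<close>.\<close>
  obtain e where e: "e > 0" "ball p e \<subseteq> U" using assms(1,3) by (auto simp: open_contains_ball)
  have hc: "continuous_on (UNIV \<times> U) h" using Cn_on_Suc_imp[of 0 h] assms(2) by simp
  have "((\<lambda>q. integral (cbox a b) (\<lambda>t. h (t, q))) has_derivative blinfun_apply (integral (cbox a b) (h' p)))
      (at p within ball p e)"
  proof (rule leibniz_rule)
    show "((\<lambda>q. h (t, q)) has_derivative blinfun_apply (h' q t)) (at q within ball p e)"
      if "q \<in> ball p e" for q t
      using h'[of q t] e that
      by (metis der has_derivative_Pair_slice has_derivative_at_withinI subsetD)
    show "(\<lambda>t. h (t, q)) integrable_on cbox a b" if "q \<in> ball p e" for q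
      using e that by (intro integrable_continuous continuous_on_compose2[OF hc] continuous_intros) auto
    show "continuous_on (ball p e \<times> cbox a b) (\<lambda>(q, t). h' q t)"
      using cont by (rule continuous_on_subset) (use e in auto)
  qed (use e in auto)
  moreover have "blinfun_apply (integral (cbox a b) (h' p)) =
      (\<lambda>v. integral {a..b} (\<lambda>t. frechet_derivative h (at (t, p)) (0, v)))"
  proof
    fix v
    have "continuous_on (cbox a b) (\<lambda>t. case (p, t) of (q, t) \<Rightarrow> h' q t)"
      by (rule continuous_on_compose2[OF cont]) (use assms(3) in \<open>auto intro: continuous_intros\<close>)
    then have "h' p integrable_on cbox a b"
      by (intro integrable_continuous) simp
    then show "blinfun_apply (integral (cbox a b) (h' p)) v =
      integral {a..b} (\<lambda>t. frechet_derivative h (at (t, p)) (0, v))"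
      by (simp add: blinfun_apply_integral h'[OF assms(3)])
  qed
  ultimately show ?thesis using e at_within_open[of p "ball p e"] by simp
qed

text \<open>The derivative along \<open>v\<close> is again a parameter integral, of the derivative
  of \<open>h\<close> along \<open>(0, v)\<close>. Joint regularity in time and space makes the
  induction close.\<close>

lemma Cn_on_integral_param:
  fixes h :: "real \<times> 'b::euclidean_space \<Rightarrow> real"
  assumes "open U" "Cn_on n h (UNIV \<times> U)"
  shows "Cn_on n (\<lambda>p. integral {a..b} (\<lambda>t. h (t, p))) U"
  using assms(2)
proof (induction n arbitrary: h)
  case 0
  then show ?case using continuous_on_integral_param[OF assms(1)] by simp
next
  case (Suc n)
  show ?case
  proof (rule Cn_on_SucI[OF assms(1)])
    have "Cn_on 1 h (UNIV \<times> U)" by (rule Cn_on_le[OF _ Suc.prems]) simp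
    then show "((\<lambda>p. integral {a..b} (\<lambda>t. h (t, p))) has_derivative
        (\<lambda>v. integral {a..b} (\<lambda>t. frechet_derivative h (at (t, p)) (0, v)))) (at p)"
      if "p \<in> U" for p
      using has_derivative_integral_param[OF assms(1) _ that] by blast
    show "Cn_on n (\<lambda>p. integral {a..b} (\<lambda>t. frechet_derivative h (at (t, p)) (0, v))) U" for v
      using Suc.prems by (intro Suc.IH[of "\<lambda>x. frechet_derivative h (at x) (0, v)"]) simp
  qed
qed


section \<open>Charts, tangent maps and comparison of metrics\<close>

text \<open>\<open>to_coord\<close>, \<open>of_coord\<close> and \<open>tangent_map\<close> are all
  derivatives of a map read in two charts. As one notion they are covered by a single chain
  rule.\<close>

definition chart_deriv ::
  "('a, 'b::euclidean_space) chart \<Rightarrow> ('a, 'b) chart \<Rightarrow> ('a \<Rightarrow> 'a) \<Rightarrow> 'a \<Rightarrow> 'b \<Rightarrow> 'b" where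
  "chart_deriv c d f x = frechet_derivative (cmap d \<circ> f \<circ> cinv c) (at (cmap c x))"

lemma to_coord_eq: "to_coord A c x = chart_deriv (chart_at A x) c id x"
  by (simp add: to_coord_def chart_deriv_def)

lemma of_coord_eq: "of_coord A c x = chart_deriv c (chart_at A x) id x"
  by (simp add: of_coord_def chart_deriv_def)

lemma tangent_map_eq: "tangent_map A f x = chart_deriv (chart_at A x) (chart_at A (f x)) f x"
  by (simp add: tangent_map_def chart_deriv_def)

text \<open>Regularity of a form that is known for fixed vectors passes through this formula to
  vectors that vary.\<close>

lemma bilinear_expand:
  fixes h :: "'b::euclidean_space \<Rightarrow> 'b \<Rightarrow> real"
  assumes "bilinear h"
  shows "h u v = (\<Sum>i\<in>Basis. \<Sum>j\<in>Basis. (u \<bullet> i) * (v \<bullet> j) * h i j)"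
proof -
  have "h u v = h (\<Sum>i\<in>Basis. (u \<bullet> i) *\<^sub>R i) (\<Sum>j\<in>Basis. (v \<bullet> j) *\<^sub>R j)"
    by (simp add: euclidean_representation)
  also have "\<dots> = (\<Sum>i\<in>Basis. \<Sum>j\<in>Basis. (u \<bullet> i) * (v \<bullet> j) * h i j)"
    unfolding bilinear_sum[OF assms] sum.cartesian_product
    by (intro sum.cong) (auto simp: bilinear_lmul[OF assms] bilinear_rmul[OF assms])
  finally show ?thesis .
qed

lemma Ck_on_Cn_on: "Ck_on k f U \<Longrightarrow> enat n \<le> k \<Longrightarrow> Cn_on n f U"
  by (simp add: Ck_on_def)

lemma Ck_on_mono: "Ck_on k f U \<Longrightarrow> l \<le> k \<Longrightarrow> Ck_on l f U"
  by (auto simp: Ck_on_def)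

lemma riemannian_metric_mono:
  "riemannian_metric X A k g \<Longrightarrow> l \<le> k \<Longrightarrow> riemannian_metric X A l g"
  unfolding riemannian_metric_def using Ck_on_mono by blast

section \<open>Charts, and the chain rule for maps read in charts\<close>

locale smooth_mfd =
  fixes X :: "'a topology" and A :: "('a, 'b::euclidean_space) chart set"
  assumes smooth_manifold: "smooth_manifold X A"
begin

lemma chart_at:
  assumes "x \<in> topspace X"
  shows chart_at_in: "chart_at A x \<in> A" and in_chart_at: "x \<in> cdom (chart_at A x)"
proof -
  have "\<exists>c. c \<in> A \<and> x \<in> cdom c"
    using assms smooth_manifold by (auto simp: smooth_manifold_def)
  from someI_ex[OF this] show "chart_at A x \<in> A" "x \<in> cdom (chart_at A x)"
    by (auto simp: chart_at_def)
qed

context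
  fixes c assumes c: "c \<in> A"
begin

lemma openin_cdom: "openin X (cdom c)"
  using c smooth_manifold by (simp add: smooth_manifold_def)

lemma cdom_subset: "cdom c \<subseteq> topspace X"
  using openin_cdom openin_subset by blast

lemma open_cimg: "open (cimg c)"
  using c smooth_manifold by (simp add: smooth_manifold_def)

lemma homeomorphic_cmap: "homeomorphic_map (subtopology X (cdom c)) (top_of_set (cimg c)) (cmap c)"
  using c smooth_manifold by (simp add: smooth_manifold_def)

lemma inj_on_cmap: "inj_on (cmap c) (cdom c)"
  using homeomorphic_imp_injective_map[OF homeomorphic_cmap] cdom_subset
  by (simp add: inf_absorb2)

lemma cinv_cmap: "x \<in> cdom c \<Longrightarrow> cinv c (cmap c x) = x"
  by (simp add: cinv_def inj_on_cmap)

lemma cinv_in: "p \<in> cimg c \<Longrightarrow> cinv c p \<in> cdom c"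
  by (auto simp: cinv_def cimg_def inv_into_into)

lemma cinv_in_topspace: "p \<in> cimg c \<Longrightarrow> cinv c p \<in> topspace X"
  using cinv_in cdom_subset by blast

lemma cmap_cinv: "p \<in> cimg c \<Longrightarrow> cmap c (cinv c p) = p"
  by (simp add: cinv_def cimg_def f_inv_into_f)

lemma cmap_in: "x \<in> cdom c \<Longrightarrow> cmap c x \<in> cimg c"
  by (simp add: cimg_def)

lemma openin_cmap_vimage: "open S \<Longrightarrow> openin X {x \<in> cdom c. cmap c x \<in> S}"
proof -
  assume "open S"
  then have "openin (top_of_set (cimg c)) (cimg c \<inter> S)" by (simp add: openin_open_Int)
  from openin_continuous_map_preimage[OF homeomorphic_imp_continuous_map[OF homeomorphic_cmap] this]
  have "openin X {x \<in> topspace X \<inter> cdom c. cmap c x \<in> cimg c \<inter> S}"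
    using openin_trans_full[OF _ openin_cdom] by simp
  moreover have "{x \<in> topspace X \<inter> cdom c. cmap c x \<in> cimg c \<inter> S} = {x \<in> cdom c. cmap c x \<in> S}"
    using cdom_subset cmap_in by blast
  ultimately show ?thesis by simp
qed

lemma open_cmap_image: "openin X W \<Longrightarrow> open (cmap c ` (cdom c \<inter> W))"
proof -
  assume "openin X W"
  then have "openin (subtopology X (cdom c)) (cdom c \<inter> W)"
    by (simp add: openin_subtopology_Int2)
  then have "openin (top_of_set (cimg c)) (cmap c ` (cdom c \<inter> W))"
    using homeomorphic_imp_open_map[OF homeomorphic_cmap] by (simp add: open_map_def)
  then show ?thesis using openin_open_eq[OF open_cimg] by blast
qed

end

text \<open>The neighbourhood condition is there because \<open>cmap d\<close> is arbitrary outside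
  \<open>cdom d\<close>: the coordinate expression reflects \<open>f\<close> only where
  \<open>f\<close> lands in \<open>cdom d\<close>.\<close>

definition chart_differentiable :: "('a \<Rightarrow> 'a) \<Rightarrow> 'a \<Rightarrow> bool" where
  "chart_differentiable f x \<longleftrightarrow>
     (\<forall>c\<in>A. \<forall>d\<in>A. x \<in> cdom c \<longrightarrow> f x \<in> cdom d \<longrightarrow>
        (cmap d \<circ> f \<circ> cinv c) differentiable (at (cmap c x)) \<and>
        (\<forall>\<^sub>F p in nhds (cmap c x). f (cinv c p) \<in> cdom d))"

lemma chart_deriv_works:
  assumes "chart_differentiable f x" "c \<in> A" "d \<in> A" "x \<in> cdom c" "f x \<in> cdom d"
  shows "((cmap d \<circ> f \<circ> cinv c) has_derivative chart_deriv c d f x) (at (cmap c x))"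
  using assms by (simp add: chart_differentiable_def chart_deriv_def flip: frechet_derivative_works)

lemma linear_chart_deriv:
  assumes "chart_differentiable f x" "c \<in> A" "d \<in> A" "x \<in> cdom c" "f x \<in> cdom d"
  shows "linear (chart_deriv c d f x)"
  using has_derivative_linear[OF chart_deriv_works[OF assms]] .

text \<open>\<open>k\<close> is a separate map that agrees with the composition on the manifold
  only. The rule thus applies to the maps \<open>T (s + t)\<close> and \<open>T t\<close>, whose
  values off the manifold are arbitrary.\<close>

lemma chart_deriv_compose:
  assumes f: "chart_differentiable f x" and h: "chart_differentiable h (f x)"
    and k: "\<And>y. y \<in> topspace X \<Longrightarrow> k y = h (f y)"
    and charts: "c \<in> A" "d \<in> A" "e \<in> A" "x \<in> cdom c" "f x \<in> cdom d" "h (f x) \<in> cdom e"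
  shows "chart_deriv c e k x v = chart_deriv d e h (f x) (chart_deriv c d f x v)"
proof -
  let ?F = "cmap d \<circ> f \<circ> cinv c" and ?H = "cmap e \<circ> h \<circ> cinv d"
  have F: "?F (cmap c x) = cmap d (f x)" using cinv_cmap charts by simp
  have "(?H has_derivative chart_deriv d e h (f x)) (at (?F (cmap c x)))"
    unfolding F using h charts by (intro chart_deriv_works)
  then have der: "(?H \<circ> ?F has_derivative chart_deriv d e h (f x) \<circ> chart_deriv c d f x) (at (cmap c x))"
    using chart_deriv_works[OF f charts(1,2,4,5)] by (rule diff_chain_at[rotated])
  \<comment> \<open>The two coordinate expressions are compared only where \<open>f\<close> lands in
    \<open>cdom d\<close>; by \<open>chart_differentiable\<close> this holds near the point.\<close>
  have "\<forall>\<^sub>F p in nhds (cmap c x). f (cinv c p) \<in> cdom d"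
    using f charts by (simp add: chart_differentiable_def)
  moreover have "\<forall>\<^sub>F p in nhds (cmap c x). p \<in> cimg c"
    using charts cmap_in open_cimg by (intro eventually_nhds_in_open) auto
  ultimately have "\<forall>\<^sub>F p in nhds (cmap c x). (?H \<circ> ?F) p = (cmap e \<circ> k \<circ> cinv c) p"
  proof eventually_elim
    case (elim p)
    then show ?case using charts by (simp add: cinv_cmap k cinv_in_topspace)
  qed
  then obtain S where "open S" "cmap c x \<in> S" "\<And>p. p \<in> S \<Longrightarrow> (?H \<circ> ?F) p = (cmap e \<circ> k \<circ> cinv c) p"
    unfolding eventually_nhds by blast
  from has_derivative_transform_within_open[OF der this]
  have "((cmap e \<circ> k \<circ> cinv c) has_derivative chart_deriv d e h (f x) \<circ> chart_deriv c d f x)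
      (at (cmap c x))" .
  from frechet_derivative_at[OF this] show ?thesis
    by (metis chart_deriv_def comp_apply)
qed

lemma chart_differentiable_id: "x \<in> topspace X \<Longrightarrow> chart_differentiable id x"
  unfolding chart_differentiable_def
proof (intro ballI impI conjI)
  fix c d assume cd: "c \<in> A" "d \<in> A" "x \<in> cdom c" "id x \<in> cdom d"
  have x: "cmap c x \<in> cmap c ` (cdom c \<inter> cdom d)" using cd by simp
  have "Cn_on 1 (cmap d \<circ> cinv c) (cmap c ` (cdom c \<inter> cdom d))"
  proof (rule Ck_on_Cn_on)
    show "Ck_on \<infinity> (cmap d \<circ> cinv c) (cmap c ` (cdom c \<inter> cdom d))"
      using smooth_manifold cd unfolding smooth_manifold_def by blast
  qed simp
  then show "(cmap d \<circ> id \<circ> cinv c) differentiable (at (cmap c x))"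
    using cd by simp
  have "\<forall>\<^sub>F p in nhds (cmap c x). p \<in> cmap c ` (cdom c \<inter> cdom d)"
    using open_cmap_image[OF cd(1) openin_cdom[OF cd(2)]] x by (intro eventually_nhds_in_open)
  then show "\<forall>\<^sub>F p in nhds (cmap c x). id (cinv c p) \<in> cdom d"
    by eventually_elim (use cinv_cmap[OF cd(1)] in auto)
qed

lemma chart_deriv_same:
  assumes "c \<in> A" "x \<in> cdom c" "\<And>y. y \<in> topspace X \<Longrightarrow> f y = y"
  shows "chart_deriv c c f x v = v"
proof -
  have "\<forall>\<^sub>F p in nhds (cmap c x). p \<in> cimg c"
    using assms cmap_in open_cimg by (intro eventually_nhds_in_open) auto
  then obtain S where S: "open S" "cmap c x \<in> S" "\<And>p. p \<in> S \<Longrightarrow> p \<in> cimg c"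
    unfolding eventually_nhds by blast
  have "((cmap c \<circ> f \<circ> cinv c) has_derivative (\<lambda>v. v)) (at (cmap c x))"
    by (rule has_derivative_transform_within_open[OF has_derivative_ident S(1,2)])
      (use S assms cmap_cinv cinv_in_topspace in simp)
  from frechet_derivative_at[OF this] show ?thesis by (metis chart_deriv_def)
qed

text \<open>Both identities are the chain rule for \<open>id\<close>, passing through an
  intermediate chart.\<close>

lemma of_coord_to_coord:
  assumes "c \<in> A" "x \<in> cdom c"
  shows "of_coord A c x (to_coord A c x v) = v" and "to_coord A c x (of_coord A c x v) = v"
proof -
  have x: "x \<in> topspace X" using assms cdom_subset by blast
  show "of_coord A c x (to_coord A c x v) = v" "to_coord A c x (of_coord A c x v) = v"
    using chart_deriv_compose[of id x id id "chart_at A x" c "chart_at A x" v]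
      chart_deriv_compose[of id x id id c "chart_at A x" c v] assms x
      chart_differentiable_id[OF x] chart_at_in[OF x] in_chart_at[OF x]
    by (simp_all add: of_coord_eq to_coord_eq chart_deriv_same)
qed

lemma of_coord_chart_at: "x \<in> topspace X \<Longrightarrow> of_coord A (chart_at A x) x v = v"
  by (simp add: of_coord_eq chart_deriv_same chart_at_in in_chart_at)

lemma linear_of_coord:
  assumes "c \<in> A" "x \<in> cdom c"
  shows "linear (of_coord A c x)"
proof -
  have x: "x \<in> topspace X" using assms cdom_subset by blast
  then show ?thesis
    unfolding of_coord_eq using assms chart_differentiable_id
    by (intro linear_chart_deriv) (auto simp: chart_at_in in_chart_at)
qed

section \<open>Riemannian metrics in coordinates and their comparison by compactness\<close>

abbreviation metric_coord :: "('a \<Rightarrow> 'b \<Rightarrow> 'b \<Rightarrow> real) \<Rightarrow> ('a, 'b) chart \<Rightarrow> 'b \<Rightarrow> 'b \<Rightarrow> 'b \<Rightarrow> real" where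
  "metric_coord g c p v w \<equiv> g (cinv c p) (of_coord A c (cinv c p) v) (of_coord A c (cinv c p) w)"

lemma bilinear_metric_coord:
  assumes "riemannian_metric X A k g" "c \<in> A" "p \<in> cimg c"
  shows "bilinear (metric_coord g c p)"
proof -
  have l: "linear (of_coord A c (cinv c p))" using assms linear_of_coord cinv_in by blast
  have b: "bilinear (g (cinv c p))"
    using assms cinv_in_topspace by (simp add: riemannian_metric_def)
  show ?thesis
    unfolding bilinear_def
    by (intro conjI allI linear_compose[OF l, unfolded o_def])
      (use b in \<open>auto simp: bilinear_def\<close>)
qed

lemma metric_coord_pos:
  assumes "riemannian_metric X A k g" "c \<in> A" "p \<in> cimg c" "v \<noteq> 0"
  shows "metric_coord g c p v v > 0"
proof -
  have x: "cinv c p \<in> cdom c" "cinv c p \<in> topspace X"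
    using assms cinv_in cinv_in_topspace by auto
  have "of_coord A c (cinv c p) v \<noteq> 0"
    using of_coord_to_coord[OF assms(2) x(1)] linear_0[OF linear_of_coord[OF assms(2) x(1)]] assms(4)
    by metis
  then show ?thesis using assms(1) x by (simp add: riemannian_metric_def)
qed

text \<open>A Riemannian metric is regular along fixed coordinate vectors; the basis expansion has
  continuous coefficients and is polynomial in \<open>v\<close>, which gives joint
  continuity.\<close>

lemma continuous_on_metric_coord:
  assumes "riemannian_metric X A k g" "c \<in> A"
  shows "continuous_on (cimg c \<times> UNIV) (\<lambda>(p, v). metric_coord g c p v v)"
proof -
  have *: "continuous_on (cimg c) (\<lambda>p. metric_coord g c p v w)" for v w
    using assms Ck_on_Cn_on[of k "\<lambda>p. metric_coord g c p v w" "cimg c" 0]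
    by (simp add: riemannian_metric_def flip: zero_enat_def)
  have "continuous_on (cimg c \<times> UNIV) (\<lambda>z. metric_coord g c (fst z) i j)" for i j
    by (rule continuous_on_compose2[OF *]) (auto intro: continuous_intros)
  then have "continuous_on (cimg c \<times> UNIV) (\<lambda>z. \<Sum>i\<in>Basis. \<Sum>j\<in>Basis.
      (snd z \<bullet> i) * (snd z \<bullet> j) * metric_coord g c (fst z) i j)"
    by (intro continuous_intros)
  then show ?thesis
    by (rule continuous_on_eq)
      (auto simp: bilinear_expand[OF bilinear_metric_coord[OF assms], symmetric])
qed

text \<open>In one fixed chart, the quotient of the two forms is continuous on the product of a
  closed ball and the unit sphere, hence bounded there by compactness.\<close>

lemma metrics_locally_comparable:
  assumes g: "riemannian_metric X A k g" and h: "riemannian_metric X A l h" and x: "x \<in> topspace X"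
  shows "\<exists>W K. openin X W \<and> x \<in> W \<and> K \<ge> 0 \<and> (\<forall>y\<in>W. \<forall>v. h y v v \<le> K * g y v v)"
proof -
  define c where "c = chart_at A x"
  have c: "c \<in> A" "x \<in> cdom c" using x by (auto simp: c_def chart_at_in in_chart_at)
  obtain e where e: "e > 0" "cball (cmap c x) e \<subseteq> cimg c"
    using open_cimg[OF c(1)] cmap_in[OF c] open_contains_cball by blast
  let ?S = "cball (cmap c x) e \<times> sphere (0::'b) 1"
  let ?G = "\<lambda>(p, v). metric_coord g c p v v" and ?H = "\<lambda>(p, v). metric_coord h c p v v"
  have G: "?G z > 0" if "z \<in> ?S" for z
  proof -
    obtain p v where z: "z = (p, v)" by (cases z)
    have "p \<in> cimg c" "v \<noteq> 0" using that e by (auto simp: z)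
    then show ?thesis using metric_coord_pos[OF g c(1)] by (simp add: z)
  qed
  have "continuous_on ?S (\<lambda>z. ?H z / ?G z)"
  proof (intro continuous_on_divide)
    have S: "?S \<subseteq> cimg c \<times> UNIV" using e by blast
    show "continuous_on ?S ?H" by (rule continuous_on_subset[OF continuous_on_metric_coord[OF h c(1)] S])
    show "continuous_on ?S ?G" by (rule continuous_on_subset[OF continuous_on_metric_coord[OF g c(1)] S])
    show "\<forall>z\<in>?S. ?G z \<noteq> 0" using G by force
  qed
  then have "compact ((\<lambda>z. ?H z / ?G z) ` ?S)"
    by (intro compact_continuous_image compact_Times) auto
  then obtain K where K: "K > 0" "\<And>z. z \<in> ?S \<Longrightarrow> \<bar>?H z / ?G z\<bar> \<le> K"
    using compact_imp_bounded bounded_pos by (metis (no_types, lifting) imageI real_norm_def)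
  have unit: "metric_coord h c p v v \<le> K * metric_coord g c p v v"
    if "p \<in> cball (cmap c x) e" "norm v = 1" for p v
    using K(2)[of "(p, v)"] G[of "(p, v)"] that by (auto simp: abs_le_iff divide_simps)
  have coord: "metric_coord h c p v v \<le> K * metric_coord g c p v v" if p: "p \<in> cball (cmap c x) e" for p v
  proof (cases "v = 0")
    case True
    have "p \<in> cimg c" using p e by blast
    with True show ?thesis
      using bilinear_lzero[OF bilinear_metric_coord[OF g c(1)]]
        bilinear_lzero[OF bilinear_metric_coord[OF h c(1)]] by simp
  next
    case False
    define u where "u = (1 / norm v) *\<^sub>R v"
    have u: "norm u = 1" "v = norm v *\<^sub>R u" using False by (auto simp: u_def)
    have pc: "p \<in> cimg c" using p e by blast
    \<comment> \<open>Both forms are homogeneous of degree two, which carries the bound from unit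
      vectors to all vectors.\<close>
    have s: "b v v = (norm v)\<^sup>2 * b u u" if b: "bilinear b" for b :: "'b \<Rightarrow> 'b \<Rightarrow> real"
      using u(2) bilinear_lmul[OF b, of "norm v" u "norm v *\<^sub>R u"] bilinear_rmul[OF b, of u "norm v" u]
      by (simp add: power2_eq_square)
    have "(norm v)\<^sup>2 * metric_coord h c p u u \<le> (norm v)\<^sup>2 * (K * metric_coord g c p u u)"
      using unit[OF p u(1)] by (intro mult_left_mono) auto
    then show ?thesis
      unfolding s[OF bilinear_metric_coord[OF g c(1) pc]] s[OF bilinear_metric_coord[OF h c(1) pc]]
      by (simp add: algebra_simps)
  qed
  let ?W = "{y \<in> cdom c. cmap c y \<in> ball (cmap c x) e}"
  have "h y v v \<le> K * g y v v" if "y \<in> ?W" for y v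
    using coord[of "cmap c y" "to_coord A c y v"] that c
    by (simp add: cinv_cmap of_coord_to_coord)
  moreover have "openin X ?W" using openin_cmap_vimage[OF c(1)] by blast
  ultimately show ?thesis using c e K(1) by (intro exI[of _ ?W] exI[of _ K]) auto
qed

text \<open>Over a finite subcover, the sum of the local constants dominates each of them; adding 1
  makes the constant strictly positive.\<close>

lemma metrics_comparable:
  assumes g: "riemannian_metric X A k g" and h: "riemannian_metric X A l h" and X: "compact_space X"
  shows "\<exists>K>0. \<forall>x\<in>topspace X. \<forall>v. h x v v \<le> K * g x v v"
proof -
  define P where "P W K \<longleftrightarrow> K \<ge> 0 \<and> (\<forall>y\<in>W. \<forall>v. h y v v \<le> K * g y v v)" for W K
  have g0: "g x v v \<ge> 0" if "x \<in> topspace X" for x v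
    using g that bilinear_lzero[of "g x" v] by (cases "v = 0") (auto simp: riemannian_metric_def less_imp_le)
  let ?U = "{W. openin X W \<and> (\<exists>K. P W K)}"
  have cover: "topspace X \<subseteq> \<Union>?U"
    using metrics_locally_comparable[OF g h] unfolding P_def by fastforce
  obtain F where F: "finite F" "F \<subseteq> ?U" "topspace X \<subseteq> \<Union>F"
    using X[unfolded compact_space_alt, rule_format, of ?U] cover by auto
  have "\<forall>W\<in>F. \<exists>K. P W K" using F(2) by blast
  from bchoice[OF this] obtain \<kappa> where \<kappa>: "\<And>W. W \<in> F \<Longrightarrow> P W (\<kappa> W)" by blast
  have nonneg: "sum \<kappa> F \<ge> 0" using \<kappa> by (intro sum_nonneg) (auto simp: P_def)
  have "h x v v \<le> (sum \<kappa> F + 1) * g x v v" if x: "x \<in> topspace X" for x v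
  proof -
    obtain W where W: "W \<in> F" "x \<in> W" using F(3) x by blast
    have "\<kappa> W \<le> sum \<kappa> F" using \<kappa> W F(1) by (intro member_le_sum) (auto simp: P_def)
    then have "\<kappa> W * g x v v \<le> (sum \<kappa> F + 1) * g x v v"
      using g0[OF x] by (intro mult_right_mono) auto
    moreover have "h x v v \<le> \<kappa> W * g x v v" using \<kappa>[OF W(1)] W(2) by (simp add: P_def)
    ultimately show ?thesis by simp
  qed
  then show ?thesis using nonneg by (intro exI[of _ "sum \<kappa> F + 1"]) auto
qed

end


section \<open>Hyperbolic cocycles\<close>

text \<open>\<open>T\<close> and \<open>D\<close> are arbitrary families here, so that reversing
  time is merely another choice of arguments.\<close>

definition averaged_metric ::
  "('a \<Rightarrow> 'b \<Rightarrow> 'b \<Rightarrow> real) \<Rightarrow> (real \<Rightarrow> 'a \<Rightarrow> 'a) \<Rightarrow> (real \<Rightarrow> 'a \<Rightarrow> 'b \<Rightarrow> 'b) \<Rightarrow> real \<Rightarrow>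
   'a \<Rightarrow> 'b \<Rightarrow> 'b \<Rightarrow> real" where
  "averaged_metric g T D L x v w = integral {-L..L} (\<lambda>t. g (T t x) (D t x v) (D t x w))"

text \<open>The substitution of \<open>- t\<close> for \<open>t\<close> preserves the symmetric
  window, so one metric serves both time directions.\<close>

lemma averaged_metric_reverse:
  "averaged_metric g (\<lambda>t. T (- t)) (\<lambda>t. D (- t)) L = averaged_metric g T D L"
proof (intro ext)
  fix x :: 'a and v w :: 'b
  show "averaged_metric g (\<lambda>t. T (- t)) (\<lambda>t. D (- t)) L x v w = averaged_metric g T D L x v w"
    using Henstock_Kurzweil_Integration.integral_reflect_real[of L "-L" "\<lambda>t. g (T t x) (D t x v) (D t x w)"]
    by (simp add: averaged_metric_def)
qed

text \<open>The exponent carries a factor 2 because \<open>h\<close> is a squared norm. Asking for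
  expansion between any two nonnegative times makes the condition pass along the orbit.\<close>

definition expanding_cone ::
  "(real \<Rightarrow> 'a \<Rightarrow> 'a) \<Rightarrow> (real \<Rightarrow> 'a \<Rightarrow> 'b \<Rightarrow> 'b) \<Rightarrow> ('a \<Rightarrow> 'b \<Rightarrow> 'b \<Rightarrow> real) \<Rightarrow> real \<Rightarrow> 'a \<Rightarrow> 'b set" where
  "expanding_cone T D h \<sigma> x = {v. \<forall>s\<ge>0. \<forall>t\<ge>s.
     h (T t x) (D t x v) (D t x v) \<ge> exp (2 * \<sigma> * (t - s)) * h (T s x) (D s x v) (D s x v)}"

text \<open>Weaker than Cauchy-Schwarz, but free of square roots.\<close>

lemma psd_form_add_bounds:
  fixes b :: "'b::real_vector \<Rightarrow> 'b \<Rightarrow> real"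
  assumes b: "bilinear b" and sym: "\<And>v w. b v w = b w v" and nonneg: "\<And>v. b v v \<ge> 0" and \<epsilon>: "\<epsilon> > 0"
  shows "b (v + w) (v + w) \<le> (1 + \<epsilon>) * b v v + (1 + 1 / \<epsilon>) * b w w"
    and "b (v + w) (v + w) \<ge> (1 - \<epsilon>) * b v v - (1 + 1 / \<epsilon>) * b w w"
proof -
  have add: "b (v + w) (v + w) = b v v + 2 * b v w + b w w"
    by (simp add: bilinear_ladd[OF b] bilinear_radd[OF b] sym[of w v])
  \<comment> \<open>Nonnegativity of the form on combinations of \<open>v\<close> and
    \<open>w\<close>, divided by \<open>\<epsilon>\<close>, controls the cross term: from above with
    \<open>c = -1\<close>, from below with \<open>c = 1\<close>.\<close>
  have "0 \<le> b (\<epsilon> *\<^sub>R v + c *\<^sub>R w) (\<epsilon> *\<^sub>R v + c *\<^sub>R w) / \<epsilon>" for c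
    using \<epsilon> nonneg by simp
  also have "b (\<epsilon> *\<^sub>R v + c *\<^sub>R w) (\<epsilon> *\<^sub>R v + c *\<^sub>R w) / \<epsilon> =
      \<epsilon> * b v v + 2 * c * b v w + c\<^sup>2 * b w w / \<epsilon>" for c
    using \<epsilon> by (simp add: bilinear_ladd[OF b] bilinear_radd[OF b] sym[of w v] bilinear_lmul[OF b]
        bilinear_rmul[OF b] power2_eq_square add_divide_distrib algebra_simps)
  finally have c: "0 \<le> \<epsilon> * b v v + 2 * c * b v w + c\<^sup>2 * b w w / \<epsilon>" for c .
  show "b (v + w) (v + w) \<le> (1 + \<epsilon>) * b v v + (1 + 1 / \<epsilon>) * b w w"
    using c[of "-1"] add by (simp add: algebra_simps)
  show "b (v + w) (v + w) \<ge> (1 - \<epsilon>) * b v v - (1 + 1 / \<epsilon>) * b w w"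
    using c[of 1] add nonneg[of w] by (simp add: algebra_simps)
qed

text \<open>A choice of decomposition exists for every vector; its uniqueness forces the choice to
  be linear.\<close>

lemma direct_sum3_projections:
  fixes P Q R :: "'b::euclidean_space set"
  assumes "direct_sum3 P Q R"
  obtains p q r where "linear p" "linear q" "linear r"
    "\<forall>v. p v \<in> P \<and> q v \<in> Q \<and> r v \<in> R \<and> p v + q v + r v = v"
    "\<forall>v\<in>R. p v = 0 \<and> q v = 0 \<and> r v = v"
proof -
  have sub: "subspace P" "subspace Q" "subspace R"
    and zero: "\<And>a b c. a \<in> P \<Longrightarrow> b \<in> Q \<Longrightarrow> c \<in> R \<Longrightarrow> a + b + c = 0 \<Longrightarrow> a = 0 \<and> b = 0 \<and> c = 0"
    using assms by (auto simp: direct_sum3_def)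
  have "\<forall>v. \<exists>z. fst z \<in> P \<and> fst (snd z) \<in> Q \<and> snd (snd z) \<in> R \<and> v = fst z + fst (snd z) + snd (snd z)"
    using assms by (fastforce simp: direct_sum3_def)
  then obtain f where f: "\<And>v. fst (f v) \<in> P" "\<And>v. fst (snd (f v)) \<in> Q" "\<And>v. snd (snd (f v)) \<in> R"
    "\<And>v. v = fst (f v) + fst (snd (f v)) + snd (snd (f v))"
    by metis
  have uniq: "f v = (a, b, c)" if "a \<in> P" "b \<in> Q" "c \<in> R" "v = a + b + c" for a b c v
    using zero[of "fst (f v) - a" "fst (snd (f v)) - b" "snd (snd (f v)) - c"] that f(1-3)[of v] f(4)[of v]
    by (auto simp: subspace_diff sub prod_eq_iff algebra_simps)
  have "f (v + w) = f v + f w" for v w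
  proof -
    have "v + w = (fst (f v) + fst (f w)) + (fst (snd (f v)) + fst (snd (f w))) +
        (snd (snd (f v)) + snd (snd (f w)))"
      using arg_cong2[OF f(4)[of v] f(4)[of w], of "(+)"] by (simp only: ac_simps)
    from uniq[OF _ _ _ this] f(1-3) show ?thesis by (simp add: subspace_add sub prod_eq_iff)
  qed
  moreover have "f (k *\<^sub>R v) = k *\<^sub>R f v" for k v
    using uniq[of "k *\<^sub>R fst (f v)" "k *\<^sub>R fst (snd (f v))" "k *\<^sub>R snd (snd (f v))" "k *\<^sub>R v"]
      f(1-3) f(4)[of v] by (simp add: subspace_scale sub prod_eq_iff flip: scaleR_add_right)
  ultimately have "linear f" by (intro linearI)
  then have "linear (fst \<circ> f)" "linear (fst \<circ> snd \<circ> f)" "linear (snd \<circ> snd \<circ> f)"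
    by (auto intro!: linear_compose linear_fst linear_snd simp: comp_assoc)
  moreover have "f v = (0, 0, v)" if "v \<in> R" for v
    using uniq[of 0 0 v v] that by (simp add: subspace_0 sub)
  ultimately show ?thesis
    using f(1-3) f(4)[symmetric] by (intro that[of "fst \<circ> f" "fst \<circ> snd \<circ> f" "snd \<circ> snd \<circ> f"]) auto
qed

text \<open>A linear cocycle over a flow with a fibre metric, separated from the manifold: only
  continuity in time along orbits enters. Reversing time gives another instance.\<close>

locale metric_cocycle =
  fixes M :: "'a set" and T :: "real \<Rightarrow> 'a \<Rightarrow> 'a" and D :: "real \<Rightarrow> 'a \<Rightarrow> 'b::euclidean_space \<Rightarrow> 'b"
    and g :: "'a \<Rightarrow> 'b \<Rightarrow> 'b \<Rightarrow> real" and L :: real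
  assumes T_in: "x \<in> M \<Longrightarrow> T t x \<in> M"
    and T_zero: "x \<in> M \<Longrightarrow> T 0 x = x"
    and T_add: "x \<in> M \<Longrightarrow> T (s + t) x = T s (T t x)"
    and linear_D: "x \<in> M \<Longrightarrow> linear (D t x)"
    and D_zero: "x \<in> M \<Longrightarrow> D 0 x v = v"
    and D_add: "x \<in> M \<Longrightarrow> D (s + t) x v = D s (T t x) (D t x v)"
    and bilinear_g: "x \<in> M \<Longrightarrow> bilinear (g x)"
    and g_sym: "x \<in> M \<Longrightarrow> g x v w = g x w v"
    and g_pos: "x \<in> M \<Longrightarrow> v \<noteq> 0 \<Longrightarrow> g x v v > 0"
    and continuous: "x \<in> M \<Longrightarrow> continuous_on UNIV (\<lambda>t. g (T t x) (D t x v) (D t x w))"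
    and L_pos: "L > 0"
begin

abbreviation q :: "real \<Rightarrow> 'a \<Rightarrow> 'b \<Rightarrow> real" where
  "q t x v \<equiv> g (T t x) (D t x v) (D t x v)"

abbreviation g1 :: "'a \<Rightarrow> 'b \<Rightarrow> 'b \<Rightarrow> real" where "g1 \<equiv> averaged_metric g T D L"

lemma g_nonneg: "x \<in> M \<Longrightarrow> g x v v \<ge> 0"
  using g_pos[of x v] bilinear_lzero[OF bilinear_g, of x v] by (cases "v = 0") (auto simp: less_imp_le)

lemma reverse: "metric_cocycle M (\<lambda>t. T (- t)) (\<lambda>t. D (- t)) g L"
proof (rule metric_cocycle.intro)
  fix x s t v w assume x: "x \<in> M"
  show "T (- (s + t)) x = T (- s) (T (- t) x)" using T_add[OF x, of "-s" "-t"] by simp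
  show "D (- (s + t)) x v = D (- s) (T (- t) x) (D (- t) x v)"
    using D_add[OF x, of "-s" "-t"] by simp
  show "continuous_on UNIV (\<lambda>t. g (T (- t) x) (D (- t) x v) (D (- t) x w))"
    by (rule continuous_on_compose2[OF continuous[OF x]]) (auto intro: continuous_intros)
qed (simp_all add: T_in T_zero linear_D D_zero bilinear_g g_pos L_pos g_sym)

lemma bilinear_pullback: "x \<in> M \<Longrightarrow> bilinear (\<lambda>v w. g (T t x) (D t x v) (D t x w))"
  using bilinear_g[OF T_in, of x t] linear_D[of x t]
  by (auto simp: bilinear_def intro: linear_compose[unfolded o_def])

lemma integrable_pullback: "x \<in> M \<Longrightarrow> (\<lambda>t. g (T t x) (D t x v) (D t x w)) integrable_on {a..b}"
  using continuous by (intro integrable_continuous_real) (blast intro: continuous_on_subset)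

lemma bilinear_g1:
  assumes x: "x \<in> M"
  shows "bilinear (g1 x)"
proof -
  note b = bilinear_pullback[OF x]
  show ?thesis
    unfolding bilinear_def
    by (intro conjI allI linearI)
      (auto simp: averaged_metric_def bilinear_ladd[OF b] bilinear_radd[OF b] bilinear_lmul[OF b]
        bilinear_rmul[OF b] integrable_pullback[OF x] integral_add)
qed

lemma g1_sym: "x \<in> M \<Longrightarrow> g1 x v w = g1 x w v"
  unfolding averaged_metric_def by (intro integral_cong g_sym T_in)

lemma g1_nonneg: "x \<in> M \<Longrightarrow> g1 x v v \<ge> 0"
  unfolding averaged_metric_def by (intro integral_nonneg integrable_pullback g_nonneg T_in)

text \<open>If the integral of the continuous nonnegative integrand were zero, the integrand would
  vanish at time 0, where it is \<open>g x v v\<close>.\<close>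

lemma g1_pos:
  assumes x: "x \<in> M" and v: "v \<noteq> 0"
  shows "g1 x v v > 0"
proof -
  have "g1 x v v \<noteq> 0"
  proof
    assume "g1 x v v = 0"
    then have "((\<lambda>t. q t x v) has_integral 0) (cbox (-L) L)"
      using integrable_integral[OF integrable_pullback[OF x, of v v "-L" L]]
      by (simp add: averaged_metric_def)
    then have "q 0 x v = 0"
      using L_pos continuous_on_subset[OF continuous[OF x, of v v]] g_nonneg[OF T_in[OF x]]
      by (intro has_integral_0_cbox_imp_0[of "-L" L "\<lambda>t. q t x v"]) auto
    then show False using g_pos[OF x v] by (simp add: T_zero x D_zero)
  qed
  then show ?thesis using g1_nonneg[OF x, of v] by simp
qed

text \<open>By the cocycle property, moving the vector along its orbit moves the averaging
  window.\<close>

lemma g1_shift: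
  assumes x: "x \<in> M"
  shows "g1 (T s x) (D s x v) (D s x v) = integral {s - L..s + L} (\<lambda>t. q t x v)"
proof -
  have "g1 (T s x) (D s x v) (D s x v) = integral {- L..L} (\<lambda>t. q (t + s) x v)"
    by (simp add: averaged_metric_def T_add D_add x)
  also have "\<dots> = integral {s - L..s + L} (\<lambda>t. q t x v)"
    using integral_shift_Icc_real[of "- L" L "\<lambda>t. q t x v" s] by (simp add: o_def add.commute)
  finally show ?thesis .
qed

text \<open>After the shift, time enters only through the end points of the window, so the
  fundamental theorem of calculus leaves the boundary terms.\<close>

lemma has_derivative_g1:
  assumes x: "x \<in> M"
  shows "((\<lambda>s. g1 (T s x) (D s x v) (D s x v)) has_real_derivative
    q (s + L) x v - q (s - L) x v) (at s)"
proof -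
  \<comment> \<open>The base point lies one unit to the left of the window at time \<open>s\<close>,
    so it stays to the left of the window for all \<open>r > s - 1\<close>.\<close>
  define a where "a = s - L - 1"
  define F where "F u = integral {a..u} (\<lambda>t. q t x v)" for u
  have cont: "continuous_on S (\<lambda>t. q t x v)" for S
    using continuous[OF x] continuous_on_subset by blast
  have F: "(F has_real_derivative q u x v) (at u)" if "u > a" for u
  proof -
    have "(F has_vector_derivative q u x v) (at u within {a..u + 1})"
      unfolding F_def using that cont by (intro integral_has_vector_derivative) auto
    moreover have "at u within {a..u + 1} = at u"
      using that by (intro at_within_interior) auto
    ultimately show ?thesis by (simp add: has_real_derivative_iff_has_vector_derivative)
  qed
  have "((\<lambda>r. F (r + L) - F (r - L)) has_real_derivative q (s + L) x v - q (s - L) x v) (at s)"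
    using L_pos by (auto intro!: derivative_eq_intros DERIV_chain2[OF F] simp: a_def)
  then show ?thesis
  proof (rule has_field_derivative_transform_within_open)
    show "F (r + L) - F (r - L) = g1 (T r x) (D r x v) (D r x v)" if "r \<in> {s - 1<..}" for r
      using that L_pos Henstock_Kurzweil_Integration.integral_combine[of a "r - L" "r + L" "\<lambda>t. q t x v"]
        integrable_pullback[OF x, of v v]
      by (simp add: F_def g1_shift[OF x] a_def)
  qed auto
qed

end

text \<open>All rates refer to squared norms. The locale yields the cone around \<open>Eu\<close>,
  against which \<open>Es\<close> and \<open>Ef\<close> enter through boundedness in forward time;
  the cone around \<open>Es\<close> arises from reversed time. \<open>K\<close> collects the bounds
  that compactness provides.\<close>

locale hyperbolic_cocycle = metric_cocycle M T D g L
  for M :: "'a set" and T :: "real \<Rightarrow> 'a \<Rightarrow> 'a" and D :: "real \<Rightarrow> 'a \<Rightarrow> 'b::euclidean_space \<Rightarrow> 'b"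
    and g :: "'a \<Rightarrow> 'b \<Rightarrow> 'b \<Rightarrow> real" and L :: real +
  fixes Es Ef Eu :: "'a \<Rightarrow> 'b set" and C \<kappa> K :: real
  assumes splitting: "x \<in> M \<Longrightarrow> direct_sum3 (Es x) (Ef x) (Eu x)"
    and D_Eu: "x \<in> M \<Longrightarrow> v \<in> Eu x \<Longrightarrow> D t x v \<in> Eu (T t x)"
    and stable: "x \<in> M \<Longrightarrow> v \<in> Es x \<Longrightarrow> t \<ge> 0 \<Longrightarrow> g (T t x) (D t x v) (D t x v) \<le> C * g x v v"
    and center: "x \<in> M \<Longrightarrow> v \<in> Ef x \<Longrightarrow> t \<ge> 0 \<Longrightarrow> g (T t x) (D t x v) (D t x v) \<le> C * g x v v"
    and unstable: "x \<in> M \<Longrightarrow> v \<in> Eu x \<Longrightarrow> t \<ge> 0 \<Longrightarrow>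
      g (T (- t) x) (D (- t) x v) (D (- t) x v) \<le> C * exp (- \<kappa> * t) * g x v v"
    and C_pos: "C > 0" and \<kappa>_pos: "\<kappa> > 0" and K_pos: "K > 0"
    and L_large: "C * exp (- \<kappa> * (2 * L)) \<le> 1 / 2"
    and bound_L: "x \<in> M \<Longrightarrow> g (T L x) (D L x v) (D L x v) \<le> K * g x v v"
    and bound_minus_L: "x \<in> M \<Longrightarrow> g (T (- L) x) (D (- L) x v) (D (- L) x v) \<le> K * g x v v"
    and bound_avg: "x \<in> M \<Longrightarrow> averaged_metric g T D L x v v \<le> K * g x v v"
begin

text \<open>The value makes \<open>2 * \<sigma>\<close> times the bound
  \<open>2 * L * C * q L x v\<close> of \<open>g1 x v v\<close> on \<open>Eu\<close> equal to a
  quarter of \<open>q L x v\<close>.\<close>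

definition \<sigma> :: real where "\<sigma> = 1 / (16 * L * C)"

lemma \<sigma>_pos: "\<sigma> > 0"
  using C_pos L_pos by (simp add: \<sigma>_def)

section \<open>Growth along the unstable bundle and near it\<close>

lemma Eu_growth:
  assumes x: "x \<in> M" and v: "v \<in> Eu x" and "s \<le> t"
  shows "q s x v \<le> C * exp (- \<kappa> * (t - s)) * q t x v"
  \<comment> \<open>The backward contraction is applied at \<open>T t x\<close> and followed for the
    time \<open>t - s\<close>.\<close>
  using unstable[OF T_in[OF x] D_Eu[OF x v], of "t - s" t] T_add[OF x, of "s - t" t]
    D_add[OF x, of "s - t" t] \<open>s \<le> t\<close> by simp

lemma Eu_growth_weak:
  assumes x: "x \<in> M" and v: "v \<in> Eu x" and "s \<le> t"
  shows "q s x v \<le> C * q t x v"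
proof -
  have "C * exp (- \<kappa> * (t - s)) \<le> C * 1" using C_pos \<kappa>_pos \<open>s \<le> t\<close> by (intro mult_left_mono) auto
  then have "C * exp (- \<kappa> * (t - s)) * q t x v \<le> C * 1 * q t x v"
    using g_nonneg[OF T_in[OF x]] by (rule mult_right_mono)
  then show ?thesis using Eu_growth[OF assms] by simp
qed

text \<open>\<open>excess x v\<close> is the derivative at \<open>t = 0\<close> of \<open>g1 (T t x) (D t x v) (D t x v)\<close>, less
  \<open>2 \<sigma>\<close> times its value there.\<close>

definition excess :: "'a \<Rightarrow> 'b \<Rightarrow> real" where
  "excess x v = q L x v - q (- L) x v - 2 * \<sigma> * g1 x v v"

text \<open>Everything is measured by \<open>q L x v\<close>: the averaged term takes at most a
  quarter, the term at \<open>- L\<close> at most a half by \<open>L_large\<close>, and the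
  remaining quarter dominates \<open>g x v v / (4 * C)\<close>.\<close>

lemma excess_Eu:
  assumes x: "x \<in> M" and v: "v \<in> Eu x"
  shows "excess x v \<ge> g x v v / (4 * C)"
proof -
  have qL: "q L x v \<ge> 0" using g_nonneg T_in x by blast
  have "g1 x v v \<le> integral {-L..L} (\<lambda>t. C * q L x v)"
    unfolding averaged_metric_def
    by (intro integral_le integrable_pullback x) (auto intro!: Eu_growth_weak x v)
  then have "g1 x v v \<le> 2 * L * C * q L x v" using L_pos by (simp add: mult_ac)
  then have "2 * \<sigma> * g1 x v v \<le> 2 * \<sigma> * (2 * L * C * q L x v)"
    using \<sigma>_pos by (intro mult_left_mono) auto
  also have "\<dots> = q L x v / 4" using L_pos C_pos by (simp add: \<sigma>_def)
  finally have 1: "2 * \<sigma> * g1 x v v \<le> q L x v / 4" .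
  have "q (- L) x v \<le> C * exp (- \<kappa> * (2 * L)) * q L x v"
    using Eu_growth[OF x v, of "-L" L] L_pos by simp
  also have "\<dots> \<le> 1 / 2 * q L x v" using L_large qL by (rule mult_right_mono)
  finally have 2: "q (- L) x v \<le> q L x v / 2" by simp
  have "g x v v \<le> C * q L x v" using Eu_growth_weak[OF x v, of 0 L] L_pos by (simp add: T_zero D_zero x)
  then have "g x v v / (4 * C) \<le> q L x v / 4" using C_pos by (simp add: divide_simps mult.commute)
  then show ?thesis using 1 2 by (simp add: excess_def)
qed

text \<open>\<open>excess\<close> is a difference of nonnegative forms, each bounded by a multiple
  of \<open>g\<close>. A small perturbation therefore costs less than the margin of
  \<open>excess_Eu\<close>.\<close>

lemma excess_near_Eu:
  "\<exists>\<delta>>0. \<forall>x\<in>M. \<forall>v\<in>Eu x. \<forall>w. g x w w \<le> \<delta> * g x v v \<longrightarrow> excess x (v + w) \<ge> 0"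
proof -
  \<comment> \<open>\<open>K'\<close> bounds the sum of the three forms in \<open>excess\<close>;
    \<open>\<epsilon>\<close> and \<open>\<delta>\<close> are chosen so that the error from
    \<open>v\<close> and the error from \<open>w\<close> each use up at most half of the
    margin.\<close>
  define K' where "K' = (2 + 2 * \<sigma>) * K"
  define \<epsilon> where "\<epsilon> = 1 / (8 * C * K')"
  define \<delta> where "\<delta> = 1 / (8 * C * ((1 + 1 / \<epsilon>) * K'))"
  have K': "K' > 0" using \<sigma>_pos K_pos by (simp add: K'_def)
  have \<epsilon>: "\<epsilon> > 0" using C_pos K' by (simp add: \<epsilon>_def)
  have \<delta>: "\<delta> > 0" using C_pos K' \<epsilon> by (simp add: \<delta>_def add_pos_pos)
  have "excess x (v + w) \<ge> 0" if x: "x \<in> M" and v: "v \<in> Eu x" and w: "g x w w \<le> \<delta> * g x v v" for x v w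
  proof -
    define S where "S u = q L x u + q (- L) x u + 2 * \<sigma> * g1 x u u" for u
    have S: "S u \<le> K' * g x u u" for u
    proof -
      have "2 * \<sigma> * g1 x u u \<le> 2 * \<sigma> * (K * g x u u)"
        using bound_avg[OF x, of u] \<sigma>_pos by (intro mult_left_mono) auto
      moreover have "K' * g x u u = K * g x u u + K * g x u u + 2 * \<sigma> * (K * g x u u)"
        by (simp add: K'_def algebra_simps)
      ultimately show ?thesis using bound_L[OF x, of u] bound_minus_L[OF x, of u] by (simp add: S_def)
    qed
    have *: "b (v + w) (v + w) \<le> (1 + \<epsilon>) * b v v + (1 + 1 / \<epsilon>) * b w w"
      "b (v + w) (v + w) \<ge> (1 - \<epsilon>) * b v v - (1 + 1 / \<epsilon>) * b w w"
      if "bilinear b" "\<And>v w. b v w = b w v" "\<And>v. b v v \<ge> 0" for b :: "'b \<Rightarrow> 'b \<Rightarrow> real"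
      using psd_form_add_bounds[OF that \<epsilon>] by auto
    note qb = *[of "\<lambda>v w. g (T t x) (D t x v) (D t x w)" for t,
        OF bilinear_pullback[OF x] g_sym[OF T_in[OF x]] g_nonneg[OF T_in[OF x]]]
    note g1b = *(1)[OF bilinear_g1[OF x] g1_sym[OF x] g1_nonneg[OF x]]
    have "2 * \<sigma> * g1 x (v + w) (v + w) \<le> 2 * \<sigma> * ((1 + \<epsilon>) * g1 x v v + (1 + 1 / \<epsilon>) * g1 x w w)"
      using g1b \<sigma>_pos by (intro mult_left_mono) auto
    \<comment> \<open>The positive term is bounded from below and the two negative terms from above;
      the losses add up to multiples of \<open>S v\<close> and \<open>S w\<close>.\<close>
    then have "excess x (v + w) \<ge> excess x v - \<epsilon> * S v - (1 + 1 / \<epsilon>) * S w"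
      using qb(2)[of L] qb(1)[of "-L"] unfolding excess_def S_def by (simp add: algebra_simps)
    moreover have "\<epsilon> * S v \<le> g x v v / (8 * C)"
      using mult_left_mono[OF S[of v], of \<epsilon>] \<epsilon> K' C_pos by (simp add: \<epsilon>_def divide_simps mult_ac)
    moreover have "(1 + 1 / \<epsilon>) * S w \<le> g x v v / (8 * C)"
    proof -
      have "(1 + 1 / \<epsilon>) * S w \<le> (1 + 1 / \<epsilon>) * (K' * (\<delta> * g x v v))"
        using S[of w] w K' \<epsilon> by (intro mult_left_mono order_trans[OF S[of w]]) auto
      also have "\<dots> = ((1 + 1 / \<epsilon>) * K' * \<delta>) * g x v v" by simp
      also have "(1 + 1 / \<epsilon>) * K' * \<delta> = 1 / (8 * C)"
        using K' \<epsilon> C_pos by (simp add: \<delta>_def) (simp add: divide_simps add_pos_pos)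
      finally show ?thesis by simp
    qed
    ultimately show ?thesis using excess_Eu[OF x v] by simp
  qed
  then show ?thesis using \<delta> by blast
qed

section \<open>The expanding cone: neighbourhood, transversality, invariance and expansion\<close>

lemma expanding_coneD:
  assumes "v \<in> expanding_cone T D g1 \<sigma> x" "0 \<le> s" "s \<le> t"
  shows "exp (2 * \<sigma> * (t - s)) * g1 (T s x) (D s x v) (D s x v) \<le> g1 (T t x) (D t x v) (D t x v)"
  using assms by (simp add: expanding_cone_def)

text \<open>Nonnegative \<open>excess\<close> is the differential inequality of growth at rate
  \<open>2 * \<sigma>\<close>: multiplied by \<open>exp (- 2 * \<sigma> * t)\<close>, the form is
  nondecreasing along the forward orbit.\<close>

lemma expanding_coneI:
  assumes x: "x \<in> M" and excess: "\<And>s. s \<ge> 0 \<Longrightarrow> excess (T s x) (D s x v) \<ge> 0"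
  shows "v \<in> expanding_cone T D g1 \<sigma> x"
  unfolding expanding_cone_def
proof (intro CollectI allI impI)
  fix s t :: real assume st: "0 \<le> s" "s \<le> t"
  let ?I = "\<lambda>s. g1 (T s x) (D s x v) (D s x v)"
  have "exp (- 2 * \<sigma> * s) * ?I s \<le> exp (- 2 * \<sigma> * t) * ?I t"
  proof (rule DERIV_nonneg_imp_nondecreasing[OF st(2)])
    fix r assume "s \<le> r" "r \<le> t"
    have "excess (T r x) (D r x v) = q (r + L) x v - q (r - L) x v - 2 * \<sigma> * ?I r"
      using T_add[OF x, of L r] T_add[OF x, of "-L" r] D_add[OF x, of L r] D_add[OF x, of "-L" r]
      by (simp add: excess_def add.commute)
    then have "0 \<le> exp (- 2 * \<sigma> * r) * (q (r + L) x v - q (r - L) x v - 2 * \<sigma> * ?I r)"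
      using excess[of r] st \<open>s \<le> r\<close> by simp
    moreover have "((\<lambda>s. exp (- 2 * \<sigma> * s) * ?I s) has_real_derivative
        exp (- 2 * \<sigma> * r) * (q (r + L) x v - q (r - L) x v - 2 * \<sigma> * ?I r)) (at r)"
      by (rule derivative_eq_intros has_derivative_g1[OF x] refl)+ (simp add: algebra_simps)
    ultimately show "\<exists>y. ((\<lambda>s. exp (- 2 * \<sigma> * s) * ?I s) has_real_derivative y) (at r) \<and> 0 \<le> y"
      by blast
  qed
  then have le: "exp (2 * \<sigma> * t) * (exp (- 2 * \<sigma> * s) * ?I s) \<le> exp (2 * \<sigma> * t) * (exp (- 2 * \<sigma> * t) * ?I t)"
    by (intro mult_left_mono) auto
  have eq: "exp (2 * \<sigma> * t) * (exp (- 2 * \<sigma> * r) * z) = exp (2 * \<sigma> * (t - r)) * z" for r z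
    by (simp add: mult.assoc[symmetric] exp_add[symmetric] right_diff_distrib)
  show "exp (2 * \<sigma> * (t - s)) * ?I s \<le> ?I t" using le unfolding eq by simp
qed

lemma center_stable_bounded:
  assumes x: "x \<in> M" and a: "a \<in> Es x" and b: "b \<in> Ef x" and t: "t \<ge> 0"
  shows "q t x (a + b) \<le> 2 * C * (g x a a + g x b b)"
proof -
  have "q t x (a + b) \<le> 2 * q t x a + 2 * q t x b"
    using psd_form_add_bounds(1)[of "\<lambda>v w. g (T t x) (D t x v) (D t x w)" 1 a b,
        OF bilinear_pullback[OF x] g_sym[OF T_in[OF x]] g_nonneg[OF T_in[OF x]]] by simp
  then show ?thesis using stable[OF x a t] center[OF x b t] by (simp add: algebra_simps)
qed

text \<open>Near \<open>Eu\<close> the center-stable part is small and stays bounded, while the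
  unstable part cannot shrink by more than a constant factor. So the ratio stays below the threshold
  of \<open>excess_near_Eu\<close> at all future times, and smallness at time 0 is an open
  condition.\<close>

lemma Eu_subset_interior:
  assumes x: "x \<in> M"
  shows "Eu x - {0} \<subseteq> interior (expanding_cone T D g1 \<sigma> x)"
proof -
  obtain \<delta> where \<delta>: "\<delta> > 0"
    "\<And>x v w. x \<in> M \<Longrightarrow> v \<in> Eu x \<Longrightarrow> g x w w \<le> \<delta> * g x v v \<Longrightarrow> excess x (v + w) \<ge> 0"
    using excess_near_Eu by blast
  obtain ps pf pu where lin: "linear ps" "linear pf" "linear pu"
    and "\<forall>v. ps v \<in> Es x \<and> pf v \<in> Ef x \<and> pu v \<in> Eu x \<and> ps v + pf v + pu v = v"
    and pu_Eu: "\<forall>v\<in>Eu x. ps v = 0 \<and> pf v = 0 \<and> pu v = v"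
    by (rule direct_sum3_projections[OF splitting[OF x]])
  then have p: "ps v \<in> Es x" "pf v \<in> Ef x" "pu v \<in> Eu x" "pu v + (ps v + pf v) = v" for v
    by (auto simp: add_ac)
  \<comment> \<open>The threshold allows for two losses: the factor \<open>2 * C\<close> of
    \<open>center_stable_bounded\<close>, and the factor \<open>C\<close> by which the unstable part
    may shrink.\<close>
  define N where "N = {v. 2 * C * (g x (ps v) (ps v) + g x (pf v) (pf v)) < \<delta> / C * g x (pu v) (pu v)}"
  have cont: "continuous_on UNIV (\<lambda>v. g x (p v) (p v))" if "linear p" for p :: "'b \<Rightarrow> 'b"
    using bilinear_continuous_on_compose[OF linear_continuous_on linear_continuous_on bilinear_g[OF x]] that
    by (simp add: linear_conv_bounded_linear)
  have "open N"
    unfolding N_def by (intro open_Collect_less continuous_intros cont lin)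
  moreover have "Eu x - {0} \<subseteq> N"
    using pu_Eu g_pos[OF x] \<delta>(1) C_pos bilinear_lzero[OF bilinear_g[OF x]] by (auto simp: N_def)
  moreover have "N \<subseteq> expanding_cone T D g1 \<sigma> x"
  proof
    fix v assume v: "v \<in> N"
    show "v \<in> expanding_cone T D g1 \<sigma> x"
    proof (rule expanding_coneI[OF x])
      fix s :: real assume s: "s \<ge> 0"
      have "q s x (ps v + pf v) \<le> \<delta> / C * g x (pu v) (pu v)"
        using center_stable_bounded[OF x p(1) p(2) s, of v v] v by (simp add: N_def)
      also have "\<dots> \<le> \<delta> / C * (C * q s x (pu v))"
        using Eu_growth_weak[OF x p(3) s, of v] \<delta> C_pos
        by (intro mult_left_mono) (auto simp: T_zero D_zero x)
      finally have "q s x (ps v + pf v) \<le> \<delta> * q s x (pu v)" using C_pos by simp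
      then have "excess (T s x) (D s x (pu v) + D s x (ps v + pf v)) \<ge> 0"
        by (intro \<delta>(2) T_in x D_Eu p(3))
      moreover have "D s x (pu v) + D s x (ps v + pf v) = D s x v"
        using p(4)[of v] linear_add[OF linear_D[OF x]] by metis
      ultimately show "excess (T s x) (D s x v) \<ge> 0" by simp
    qed
  qed
  ultimately show ?thesis using interior_maximal by blast
qed

text \<open>In the cone \<open>g1\<close> grows exponentially, whereas it is bounded along forward
  orbits in \<open>Es\<close> plus \<open>Ef\<close>.\<close>

lemma expanding_cone_inter_center_stable:
  assumes x: "x \<in> M" and v: "a + b \<in> expanding_cone T D g1 \<sigma> x" and a: "a \<in> Es x" and b: "b \<in> Ef x"
  shows "a + b = 0"
proof (rule ccontr)
  assume "a + b \<noteq> 0"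
  then have pos: "g1 x (a + b) (a + b) > 0" using g1_pos[OF x] by blast
  define B where "B = K * (2 * C * (g x a a + g x b b))"
  have "exp (2 * \<sigma> * t) * g1 x (a + b) (a + b) \<le> B" if "t \<ge> 0" for t
  proof -
    have "exp (2 * \<sigma> * t) * g1 x (a + b) (a + b) \<le> g1 (T t x) (D t x (a + b)) (D t x (a + b))"
      using expanding_coneD[OF v _ that] by (simp add: T_zero D_zero x)
    also have "\<dots> \<le> K * q t x (a + b)" using bound_avg T_in x by blast
    also have "\<dots> \<le> B"
      unfolding B_def using center_stable_bounded[OF x a b that] K_pos by (intro mult_left_mono) auto
    finally show ?thesis .
  qed
  then have le: "exp (2 * \<sigma> * t) \<le> B / g1 x (a + b) (a + b)" if "t \<ge> 0" for t
    using that pos by (simp add: pos_le_divide_eq)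
  have bound: "1 + 2 * \<sigma> * t \<le> B / g1 x (a + b) (a + b)" if "t \<ge> 0" for t
    using exp_ge_add_one_self[of "2 * \<sigma> * t"] le[OF that] by linarith
  define t where "t = \<bar>B / g1 x (a + b) (a + b)\<bar> / (2 * \<sigma>)"
  have "2 * \<sigma> * t = \<bar>B / g1 x (a + b) (a + b)\<bar>" "t \<ge> 0" using \<sigma>_pos by (auto simp: t_def)
  with bound[of t] show False by linarith
qed

lemma conefield_expanding_cone:
  "conefield X Eu (\<lambda>x. {a + b |a b. a \<in> Es x \<and> b \<in> Ef x}) (expanding_cone T D g1 \<sigma>)"
  if "topspace X = M"
  unfolding conefield_def that
proof (intro ballI conjI)
  fix x assume x: "x \<in> M"
  \<comment> \<open>The defining inequality compares quadratic forms, so scaling \<open>v\<close>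
    multiplies both sides by the same nonnegative factor.\<close>
  have scale: "c *\<^sub>R v \<in> expanding_cone T D g1 \<sigma> x" if v: "v \<in> expanding_cone T D g1 \<sigma> x" for c v
  proof -
    have "g1 (T t x) (D t x (c *\<^sub>R v)) (D t x (c *\<^sub>R v)) = c\<^sup>2 * g1 (T t x) (D t x v) (D t x v)" for t
      by (simp add: linear_scale[OF linear_D[OF x]] bilinear_lmul[OF bilinear_g1[OF T_in[OF x]]]
          bilinear_rmul[OF bilinear_g1[OF T_in[OF x]]] power2_eq_square)
    then show ?thesis
      using v by (auto simp: expanding_cone_def mult.left_commute[of _ "c\<^sup>2"] intro!: mult_left_mono)
  qed
  have zero: "0 \<in> expanding_cone T D g1 \<sigma> x"
    using bilinear_lzero[OF bilinear_g1[OF T_in[OF x]]] linear_0[OF linear_D[OF x]]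
    by (simp add: expanding_cone_def)
  then show "0 \<in> expanding_cone T D g1 \<sigma> x" .
  show "cone (expanding_cone T D g1 \<sigma> x)" using scale by (simp add: cone_def)
  show "- v \<in> expanding_cone T D g1 \<sigma> x" if "v \<in> expanding_cone T D g1 \<sigma> x" for v
    using scale[OF that, of "-1"] by simp
  show "Eu x - {0} \<subseteq> interior (expanding_cone T D g1 \<sigma> x)" using Eu_subset_interior[OF x] .
  show "expanding_cone T D g1 \<sigma> x \<inter> {a + b |a b. a \<in> Es x \<and> b \<in> Ef x} \<subseteq> {0}"
    using expanding_cone_inter_center_stable[OF x] by blast
qed

text \<open>Comparing \<open>D t x v\<close> at times \<open>s\<close> and \<open>r\<close> is
  comparing \<open>v\<close> at times \<open>s + t\<close> and \<open>r + t\<close>, which are still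
  nonnegative.\<close>

lemma expanding_cone_invariant:
  assumes x: "x \<in> M" and t: "t \<ge> 0"
  shows "D t x ` expanding_cone T D g1 \<sigma> x \<subseteq> expanding_cone T D g1 \<sigma> (T t x)"
proof (rule image_subsetI)
  fix v assume v: "v \<in> expanding_cone T D g1 \<sigma> x"
  show "D t x v \<in> expanding_cone T D g1 \<sigma> (T t x)"
    unfolding expanding_cone_def
  proof (intro CollectI allI impI)
    fix s r :: real assume "0 \<le> s" "s \<le> r"
    then show "exp (2 * \<sigma> * (r - s)) * g1 (T s (T t x)) (D s (T t x) (D t x v)) (D s (T t x) (D t x v))
      \<le> g1 (T r (T t x)) (D r (T t x) (D t x v)) (D r (T t x) (D t x v))"
      using expanding_coneD[OF v, of "s + t" "r + t"] t by (simp add: T_add D_add x)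
  qed
qed

lemma expanding_cone_expands:
  assumes x: "x \<in> M" and t: "t \<ge> 0" and v: "v \<in> expanding_cone T D g1 \<sigma> x"
  shows "metric_norm g1 (T t x) (D t x v) \<ge> exp (\<sigma> * t) * metric_norm g1 x v"
proof -
  have "exp (2 * \<sigma> * t) * g1 x v v \<le> g1 (T t x) (D t x v) (D t x v)"
    using expanding_coneD[OF v _ t] by (simp add: T_zero D_zero x)
  moreover have "exp (2 * \<sigma> * t) = (exp (\<sigma> * t))\<^sup>2" by (simp add: power2_eq_square flip: exp_add)
  ultimately have "sqrt ((exp (\<sigma> * t))\<^sup>2 * g1 x v v) \<le> metric_norm g1 (T t x) (D t x v)"
    unfolding metric_norm_def by (intro real_sqrt_le_mono) simp
  then show ?thesis by (simp add: metric_norm_def real_sqrt_mult)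
qed

end


section \<open>Flows\<close>

lemma enat_Suc_le_plus_one: "enat n \<le> r \<Longrightarrow> enat (Suc n) \<le> r + 1"
  by (cases r) (auto simp: one_enat_def)

locale mfd_flow = smooth_mfd X A
  for X :: "'a topology" and A :: "('a, 'b::euclidean_space) chart set" +
  fixes T :: "real \<Rightarrow> 'a \<Rightarrow> 'a" and r :: enat
  assumes flow: "Ck_flow X A (r + 1) T"
begin

section \<open>The flow and its tangent maps in coordinates\<close>

lemma T_zero: "x \<in> topspace X \<Longrightarrow> T 0 x = x"
  and T_in: "x \<in> topspace X \<Longrightarrow> T t x \<in> topspace X"
  and T_add: "x \<in> topspace X \<Longrightarrow> T (s + t) x = T s (T t x)"
  using flow by (auto simp: Ck_flow_def)

definition flow_dom :: "('a, 'b) chart \<Rightarrow> ('a, 'b) chart \<Rightarrow> (real \<times> 'b) set" where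
  "flow_dom c d = {(t, p). p \<in> cimg c \<and> T t (cinv c p) \<in> cdom d}"

definition flow_coord :: "('a, 'b) chart \<Rightarrow> ('a, 'b) chart \<Rightarrow> real \<times> 'b \<Rightarrow> 'b" where
  "flow_coord c d = (\<lambda>(t, p). cmap d (T t (cinv c p)))"

lemma open_flow_dom: "c \<in> A \<Longrightarrow> d \<in> A \<Longrightarrow> open (flow_dom c d)"
  using flow by (simp add: Ck_flow_def flow_dom_def Let_def)

lemma Cn_on_flow_coord:
  assumes "enat n \<le> r" "c \<in> A" "d \<in> A"
  shows "Cn_on (Suc n) (flow_coord c d) (flow_dom c d)"
proof (rule Ck_on_Cn_on)
  show "Ck_on (r + 1) (flow_coord c d) (flow_dom c d)"
    using flow assms(2,3) by (simp add: Ck_flow_def flow_dom_def flow_coord_def Let_def)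
qed (rule enat_Suc_le_plus_one[OF assms(1)])

lemma flow_coord_works:
  assumes "c \<in> A" "d \<in> A" "(t, p) \<in> flow_dom c d"
  shows "((cmap d \<circ> T t \<circ> cinv c) has_derivative
    (\<lambda>v. frechet_derivative (flow_coord c d) (at (t, p)) (0, v))) (at p)"
proof -
  have "(flow_coord c d has_derivative frechet_derivative (flow_coord c d) (at (t, p))) (at (t, p))"
    using Cn_on_Suc_has_derivative[OF Cn_on_flow_coord[of 0, OF _ assms(1,2)] assms(3)]
    by (simp flip: zero_enat_def)
  from has_derivative_Pair_slice[OF this] show ?thesis by (simp add: flow_coord_def o_def)
qed

text \<open>The derivative at fixed time is a partial derivative of the joint map, hence jointly
  regular in time and space, one order below the flow.\<close>

lemma chart_deriv_flow:
  assumes "c \<in> A" "d \<in> A" "(t, p) \<in> flow_dom c d"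
  shows "chart_deriv c d (T t) (cinv c p) v = frechet_derivative (flow_coord c d) (at (t, p)) (0, v)"
proof -
  have "cmap c (cinv c p) = p" using assms cmap_cinv by (simp add: flow_dom_def)
  then show ?thesis
    using frechet_derivative_at[OF flow_coord_works[OF assms]] by (simp add: chart_deriv_def fun_eq_iff)
qed

lemma chart_differentiable_flow:
  assumes x: "x \<in> topspace X"
  shows "chart_differentiable (T t) x"
  unfolding chart_differentiable_def
proof (intro ballI impI conjI)
  fix c d assume cd: "c \<in> A" "d \<in> A" "x \<in> cdom c" "T t x \<in> cdom d"
  have dom: "(t, cmap c x) \<in> flow_dom c d" using cd by (simp add: flow_dom_def cmap_in cinv_cmap)
  from flow_coord_works[OF cd(1,2) this]
  show "(cmap d \<circ> T t \<circ> cinv c) differentiable (at (cmap c x))" by (auto simp: differentiable_def)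
  have "open (Pair t -` flow_dom c d)"
    by (intro open_vimage open_flow_dom cd) (auto intro: continuous_intros)
  then have "\<forall>\<^sub>F p in nhds (cmap c x). p \<in> Pair t -` flow_dom c d"
    by (rule eventually_nhds_in_open) (simp add: dom)
  then show "\<forall>\<^sub>F p in nhds (cmap c x). T t (cinv c p) \<in> cdom d"
    by eventually_elim (simp add: flow_dom_def)
qed

lemma linear_tangent_map: "x \<in> topspace X \<Longrightarrow> linear (tangent_map A (T t) x)"
  unfolding tangent_map_eq
  by (intro linear_chart_deriv chart_differentiable_flow chart_at_in in_chart_at T_in)

lemma tangent_map_zero: "x \<in> topspace X \<Longrightarrow> tangent_map A (T 0) x v = v"
  by (simp add: tangent_map_eq T_zero chart_deriv_same chart_at_in in_chart_at)

lemma tangent_map_add: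
  assumes x: "x \<in> topspace X"
  shows "tangent_map A (T (s + t)) x v = tangent_map A (T s) (T t x) (tangent_map A (T t) x v)"
  unfolding tangent_map_eq T_add[OF x]
  by (intro chart_deriv_compose chart_differentiable_flow chart_at_in in_chart_at T_in x T_add)

text \<open>Both sides are the derivative of \<open>T t\<close> from the chart \<open>c\<close> to
  the selected chart at \<open>T t x\<close>, factored through two different intermediate
  charts.\<close>

lemma tangent_map_of_coord:
  assumes cd: "c \<in> A" "d \<in> A" and x: "x \<in> cdom c" "T t x \<in> cdom d"
  shows "tangent_map A (T t) x (of_coord A c x v) = of_coord A d (T t x) (chart_deriv c d (T t) x v)"
proof -
  have xX: "x \<in> topspace X" using x cd cdom_subset by blast
  note charts = chart_at_in in_chart_at T_in xX chart_differentiable_flow chart_differentiable_id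
  let ?e = "chart_at A (T t x)"
  have "chart_deriv c ?e (T t) x v = tangent_map A (T t) x (of_coord A c x v)"
    unfolding tangent_map_eq of_coord_eq
    using chart_deriv_compose[of id x "T t" "T t" c "chart_at A x" ?e v] cd x by (simp add: charts)
  moreover have "chart_deriv c ?e (T t) x v = of_coord A d (T t x) (chart_deriv c d (T t) x v)"
    unfolding of_coord_eq
    using chart_deriv_compose[of "T t" x id "T t" c d ?e v] cd x by (simp add: charts)
  ultimately show ?thesis by simp
qed

section \<open>Pulled back and averaged metrics on the manifold\<close>

definition pullback :: "('a \<Rightarrow> 'b \<Rightarrow> 'b \<Rightarrow> real) \<Rightarrow> real \<Rightarrow> 'a \<Rightarrow> 'b \<Rightarrow> 'b \<Rightarrow> real" where
  "pullback g t x v w = g (T t x) (tangent_map A (T t) x v) (tangent_map A (T t) x w)"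

lemma averaged_metric_pullback:
  "averaged_metric g T (\<lambda>t. tangent_map A (T t)) L x v w = integral {-L..L} (\<lambda>t. pullback g t x v w)"
  by (simp add: averaged_metric_def pullback_def)

text \<open>In coordinates the pullback is a sum of products of first derivatives of the flow and
  metric coefficients along the flow. One order is spent on the derivative, so a flow of class
  \<open>r + 1\<close> gives class \<open>r\<close>.\<close>

lemma Cn_on_pullback:
  assumes g: "riemannian_metric X A r g" and n: "enat n \<le> r" and c: "c \<in> A"
  shows "Cn_on n (\<lambda>(t, p). metric_coord (pullback g t) c p v w) (UNIV \<times> cimg c)"
proof (rule Cn_on_local)
  fix z assume "z \<in> (UNIV :: real set) \<times> cimg c"
  then obtain t0 p0 where z: "z = (t0, p0)" and p0: "p0 \<in> cimg c" by auto
  \<comment> \<open>No single target chart serves all times, so one is fixed near the image of the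
    given point.\<close>
  define d where "d = chart_at A (T t0 (cinv c p0))"
  have x0: "T t0 (cinv c p0) \<in> topspace X" using T_in cinv_in_topspace[OF c p0] by blast
  have d: "d \<in> A" using chart_at_in[OF x0] by (simp add: d_def)
  let ?W = "flow_dom c d"
  have W: "open ?W" using open_flow_dom[OF c d] .
  have zW: "z \<in> ?W" using p0 in_chart_at[OF x0] by (simp add: z flow_dom_def d_def)
  let ?D = "\<lambda>z v. frechet_derivative (flow_coord c d) (at z) (0, v)"
  have D: "Cn_on n (\<lambda>z. ?D z v) ?W" for v
    using Cn_on_flow_coord[OF n c d] by simp
  have Di: "Cn_on n (\<lambda>z. ?D z v \<bullet> i) ?W" for v i
    by (intro Cn_on_inner W D Cn_on_const)
  have G: "Cn_on n (\<lambda>z. metric_coord g d (flow_coord c d z) i j) ?W" for i j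
  proof (rule Cn_on_compose[OF W Cn_on_Suc_imp[OF Cn_on_flow_coord[OF n c d]]])
    show "Cn_on n (\<lambda>p. metric_coord g d p i j) (cimg d)"
      using g d n Ck_on_Cn_on[of r "\<lambda>p. metric_coord g d p i j" "cimg d" n]
      by (simp add: riemannian_metric_def)
    show "flow_coord c d ` ?W \<subseteq> cimg d"
      using cmap_in[OF d] by (auto simp: flow_coord_def flow_dom_def)
  qed
  have "Cn_on n (\<lambda>z. \<Sum>i\<in>Basis. \<Sum>j\<in>Basis. (?D z v \<bullet> i) * (?D z w \<bullet> j) *
      metric_coord g d (flow_coord c d z) i j) ?W"
    by (intro Cn_on_sum Cn_on_mult W Di G)
  then have "Cn_on n (\<lambda>(t, p). metric_coord (pullback g t) c p v w) ?W"
  proof (rule Cn_on_cong[OF W, rotated])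
    fix z assume z: "z \<in> ?W"
    obtain t p where tp: "z = (t, p)" by (cases z)
    have p: "p \<in> cimg c" "T t (cinv c p) \<in> cdom d" using z by (auto simp: tp flow_dom_def)
    have inv: "cinv d (flow_coord c d z) = T t (cinv c p)"
      using p d by (simp add: tp flow_coord_def cinv_cmap)
    have im: "flow_coord c d z \<in> cimg d" using p cmap_in[OF d] by (simp add: tp flow_coord_def)
    have *: "tangent_map A (T t) (cinv c p) (of_coord A c (cinv c p) v) =
        of_coord A d (cinv d (flow_coord c d z)) (?D z v)" for v
      using tangent_map_of_coord[OF c d cinv_in[OF c p(1)] p(2)] chart_deriv_flow[OF c d z[unfolded tp]]
      by (simp add: inv) (simp add: tp)
    show "(\<Sum>i\<in>Basis. \<Sum>j\<in>Basis. (?D z v \<bullet> i) * (?D z w \<bullet> j) *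
        metric_coord g d (flow_coord c d z) i j) =
      (case z of (t, p) \<Rightarrow> metric_coord (pullback g t) c p v w)"
      using bilinear_expand[OF bilinear_metric_coord[OF g d im], of "?D z v" "?D z w"]
      by (simp add: tp pullback_def *[unfolded tp] inv[unfolded tp])
  qed
  then show "\<exists>W. open W \<and> z \<in> W \<and> Cn_on n (\<lambda>(t, p). metric_coord (pullback g t) c p v w) W"
    using W zW by blast
qed

lemma continuous_pullback:
  assumes g: "riemannian_metric X A r g" and x: "x \<in> topspace X"
  shows "continuous_on UNIV (\<lambda>t. pullback g t x v w)"
proof -
  let ?c = "chart_at A x"
  have c: "?c \<in> A" "x \<in> cdom ?c" using chart_at_in[OF x] in_chart_at[OF x] by auto
  have *: "continuous_on (UNIV \<times> cimg ?c) (\<lambda>(t, p). metric_coord (pullback g t) ?c p v w)"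
    using Cn_on_pullback[OF g _ c(1), of 0] by (simp flip: zero_enat_def)
  have "continuous_on UNIV (\<lambda>t. case (t, cmap ?c x) of (t, p) \<Rightarrow> metric_coord (pullback g t) ?c p v w)"
    by (rule continuous_on_compose2[OF *]) (use cmap_in[OF c] in \<open>auto intro: continuous_intros\<close>)
  then show ?thesis by (simp add: cinv_cmap[OF c] of_coord_chart_at[OF x])
qed

text \<open>Positivity holds because the tangent map of \<open>T (- t)\<close> inverts that of
  \<open>T t\<close>; regularity is that of the joint expression restricted to one time.\<close>

lemma riemannian_metric_pullback:
  assumes g: "riemannian_metric X A r g"
  shows "riemannian_metric X A r (pullback g t)"
  unfolding riemannian_metric_def
proof (intro conjI ballI allI impI)
  fix x assume x: "x \<in> topspace X"
  have gx: "bilinear (g (T t x))" "\<And>v w. g (T t x) v w = g (T t x) w v"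
    "\<And>v. v \<noteq> 0 \<Longrightarrow> g (T t x) v v > 0"
    using g T_in[OF x] by (auto simp: riemannian_metric_def)
  show "bilinear (pullback g t x)"
    using gx(1) linear_tangent_map[OF x, of t]
    unfolding bilinear_def pullback_def by (auto intro: linear_compose[unfolded o_def])
  show "pullback g t x v w = pullback g t x w v" for v w
    by (simp add: pullback_def gx(2)[of "tangent_map A (T t) x v"])
  show "pullback g t x v v > 0" if "v \<noteq> 0" for v
  proof -
    have "tangent_map A (T (- t)) (T t x) (tangent_map A (T t) x v) = v"
      using tangent_map_add[OF x, of "-t" t v] by (simp add: tangent_map_zero x)
    then have "tangent_map A (T t) x v \<noteq> 0"
      using that linear_0[OF linear_tangent_map[OF T_in[OF x]]] by metis
    then show ?thesis using gx(3) by (simp add: pullback_def)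
  qed
next
  fix c v w assume c: "c \<in> A"
  show "Ck_on r (\<lambda>p. metric_coord (pullback g t) c p v w) (cimg c)"
    unfolding Ck_on_def
  proof (intro allI impI)
    fix n assume n: "enat n \<le> r"
    \<comment> \<open>The inclusion of the time slice is the constant \<open>(t, 0)\<close> plus a
      bounded linear map.\<close>
    have "Cn_on n (\<lambda>p. (t, p)) (cimg c)"
      using Cn_on_add[OF open_cimg[OF c] Cn_on_const[OF open_cimg[OF c], of n "(t, 0)"]
          Cn_on_bounded_linear[OF open_cimg[OF c], of "\<lambda>p. (0, p)"]]
      by (simp add: bounded_linear_Pair bounded_linear_zero bounded_linear_ident)
    from Cn_on_compose[OF open_cimg[OF c] this Cn_on_pullback[OF g n c]]
    show "Cn_on n (\<lambda>p. metric_coord (pullback g t) c p v w) (cimg c)" by auto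
  qed
qed

lemma metric_cocycle_flow:
  assumes g: "riemannian_metric X A r g" and L: "L > 0"
  shows "metric_cocycle (topspace X) T (\<lambda>t. tangent_map A (T t)) g L"
proof (rule metric_cocycle.intro)
  show "continuous_on UNIV (\<lambda>t. g (T t x) (tangent_map A (T t) x v) (tangent_map A (T t) x w))"
    if "x \<in> topspace X" for x v w
    using continuous_pullback[OF g that] by (simp add: pullback_def)
qed (use g L in \<open>auto simp: riemannian_metric_def T_in T_zero T_add linear_tangent_map
  tangent_map_zero tangent_map_add\<close>)

lemma riemannian_metric_averaged:
  assumes g: "riemannian_metric X A r g" and L: "L > 0"
  shows "riemannian_metric X A r (averaged_metric g T (\<lambda>t. tangent_map A (T t)) L)"
proof -
  interpret metric_cocycle "topspace X" T "\<lambda>t. tangent_map A (T t)" g L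
    using metric_cocycle_flow[OF g L] .
  have "Ck_on r (\<lambda>p. metric_coord (averaged_metric g T (\<lambda>t. tangent_map A (T t)) L) c p v w) (cimg c)"
    if c: "c \<in> A" for c v w
    unfolding Ck_on_def averaged_metric_pullback
    using Cn_on_integral_param[OF open_cimg[OF c] Cn_on_pullback[OF g _ c]] by simp
  then show ?thesis
    using bilinear_g1 g1_sym g1_pos by (auto simp: riemannian_metric_def)
qed

end

section \<open>From the hyperbolic cocycle to the Anosov flow\<close>

lemma (in smooth_mfd) uniformly_equivalent_metrics_compact:
  assumes g: "riemannian_metric X A k g" and h: "riemannian_metric X A l h" and X: "compact_space X"
  shows "uniformly_equivalent_metrics X g h"
proof -
  obtain K where K: "K > 0" "\<And>x v. x \<in> topspace X \<Longrightarrow> h x v v \<le> K * g x v v"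
    using metrics_comparable[OF g h X] by blast
  obtain K' where K': "K' > 0" "\<And>x v. x \<in> topspace X \<Longrightarrow> g x v v \<le> K' * h x v v"
    using metrics_comparable[OF h g X] by blast
  have nonneg: "metric_norm b x v \<ge> 0" if "riemannian_metric X A m b" "x \<in> topspace X" for m b x v
    using that bilinear_lzero[of "b x" v]
    by (cases "v = 0") (auto simp: metric_norm_def riemannian_metric_def less_imp_le)
  \<comment> \<open>One constant must be at least 1 and dominate the comparison constants in both
    directions.\<close>
  define c where "c = 1 + sqrt K + sqrt K'"
  have c: "c \<ge> 1" "sqrt K \<le> c" "sqrt K' \<le> c" using K(1) K'(1) by (auto simp: c_def)
  have "inverse c * metric_norm g x v \<le> metric_norm h x v \<and> metric_norm h x v \<le> c * metric_norm g x v"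
    if x: "x \<in> topspace X" for x v
  proof
    have "metric_norm g x v \<le> sqrt K' * metric_norm h x v"
      using real_sqrt_le_mono[OF K'(2)[OF x]] by (simp add: metric_norm_def real_sqrt_mult)
    also have "\<dots> \<le> c * metric_norm h x v" using c nonneg[OF h x] by (intro mult_right_mono)
    finally show "inverse c * metric_norm g x v \<le> metric_norm h x v" using c by (simp add: divide_simps mult.commute)
    have "metric_norm h x v \<le> sqrt K * metric_norm g x v"
      using real_sqrt_le_mono[OF K(2)[OF x]] by (simp add: metric_norm_def real_sqrt_mult)
    also have "\<dots> \<le> c * metric_norm g x v" using c nonneg[OF g x] by (intro mult_right_mono)
    finally show "metric_norm h x v \<le> c * metric_norm g x v" .
  qed
  then show ?thesis using c(1) by (auto simp: uniformly_equivalent_metrics_def)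
qed

lemma direct_sum3_swap:
  assumes "direct_sum3 P Q R"
  shows "direct_sum3 R Q P"
proof -
  have "a + b + c = c + b + a" for a b c :: 'a
    by (simp add: ac_simps)
  then show ?thesis
    using assms unfolding direct_sum3_def by metis
qed

text \<open>Turns the norm estimates of an Anosov flow into estimates on quadratic forms.\<close>

lemma metric_norm_le_imp_form_le:
  assumes "metric_norm g y w \<le> a * metric_norm g x v" "g x v v \<ge> 0" "g y w w \<ge> 0"
  shows "g y w w \<le> a\<^sup>2 * g x v v"
  using power_mono[OF assms(1), of 2] assms(2,3) by (simp add: metric_norm_def power_mult_distrib)

theorem lemma9:
  fixes X :: "'a topology" and A :: "('a, 'b::euclidean_space) chart set"
    and g :: "'a \<Rightarrow> 'b \<Rightarrow> 'b \<Rightarrow> real" and r :: enat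
    and T :: "real \<Rightarrow> 'a \<Rightarrow> 'a" and Es Ef Eu :: "'a \<Rightarrow> 'b set"
  assumes "compact_riemannian_manifold X A g"
    and "anosov_flow X A g (r + 1) T Es Ef Eu"
  shows "\<exists>g1 Cu Cs. \<exists>\<sigma>>0.
    riemannian_metric X A r g1 \<and>
    uniformly_equivalent_metrics X g g1 \<and>
    invariant_unstable_conefield X A T Es Ef Eu Cu \<and>
    invariant_stable_conefield X A T Es Ef Eu Cs \<and>
    (\<forall>x\<in>topspace X.
      (\<forall>t\<ge>0. \<forall>v\<in>Cu x. metric_norm g1 (T t x) (tangent_map A (T t) x v)
         \<ge> exp (\<sigma> * t) * metric_norm g1 x v) \<and>
      (\<forall>t\<ge>0. \<forall>v\<in>Cs x. metric_norm g1 (T (- t) x) (tangent_map A (T (- t)) x v)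
         \<ge> exp (\<sigma> * t) * metric_norm g1 x v))"
proof -
  let ?M = "topspace X" and ?D = "\<lambda>t. tangent_map A (T t)"
  interpret mfd_flow X A T r
    using assms by unfold_locales (auto simp: compact_riemannian_manifold_def anosov_flow_def)
  have X: "compact_space X" and g: "riemannian_metric X A r g"
    using assms riemannian_metric_mono[of X A \<infinity> g r] by (auto simp: compact_riemannian_manifold_def)
  have split: "\<And>x. x \<in> ?M \<Longrightarrow> direct_sum3 (Es x) (Ef x) (Eu x)"
    and inv: "\<And>x t. x \<in> ?M \<Longrightarrow> ?D t x ` Es x = Es (T t x)"
      "\<And>x t. x \<in> ?M \<Longrightarrow> ?D t x ` Eu x = Eu (T t x)"
    using assms(2) by (auto simp: anosov_flow_def invariant_distribution_def)
  obtain C0 \<kappa>0 where C0: "C0 > 0" "\<kappa>0 > 0"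
    and rates: "\<forall>x\<in>?M.
      (\<forall>v\<in>Es x. \<forall>t\<ge>0. metric_norm g (T t x) (?D t x v) \<le> C0 * exp (- \<kappa>0 * t) * metric_norm g x v) \<and>
      (\<forall>v\<in>Eu x. \<forall>t\<ge>0. metric_norm g (T (- t) x) (?D (- t) x v) \<le> C0 * exp (- \<kappa>0 * t) * metric_norm g x v) \<and>
      (\<forall>v\<in>Ef x. \<forall>t. inverse C0 * metric_norm g x v \<le> metric_norm g (T t x) (?D t x v) \<and>
         metric_norm g (T t x) (?D t x v) \<le> C0 * metric_norm g x v)"
    using assms(2) unfolding anosov_flow_def by blast
  \<comment> \<open>Passing to squared norms squares the constant and doubles the rate. With this
    \<open>L\<close> the exponent \<open>\<kappa> * (2 * L)\<close> is \<open>2 * C\<close>, and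
    \<open>2 * C \<le> exp (2 * C)\<close> yields the factor \<open>1 / 2\<close>.\<close>
  define C \<kappa> L where "C = C0\<^sup>2" and "\<kappa> = 2 * \<kappa>0" and "L = C / \<kappa>"
  have C: "C > 0" "\<kappa> > 0" "L > 0" using C0 by (auto simp: C_def \<kappa>_def L_def)
  have L_large: "C * exp (- \<kappa> * (2 * L)) \<le> 1 / 2"
  proof -
    have "2 * C \<le> exp (2 * C)" using exp_ge_add_one_self[of "2 * C"] by linarith
    then show ?thesis using C by (simp add: L_def exp_minus divide_simps mult.commute)
  qed
  let ?g1 = "averaged_metric g T ?D L"
  interpret base: metric_cocycle ?M T ?D g L using metric_cocycle_flow[OF g C(3)] .
  have g1: "riemannian_metric X A r ?g1" using riemannian_metric_averaged[OF g C(3)] .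
  have sq: "(C0 * exp (- \<kappa>0 * t))\<^sup>2 = C * exp (- \<kappa> * t)" for t
    by (simp add: C_def \<kappa>_def power_mult_distrib flip: exp_double)
  have form_le: "g (T t x) (?D t x v) (?D t x v) \<le> a\<^sup>2 * g x v v"
    if "x \<in> ?M" "metric_norm g (T t x) (?D t x v) \<le> a * metric_norm g x v" for x t v a
    using that by (intro metric_norm_le_imp_form_le base.g_nonneg T_in)
  have Es_rate: "g (T t x) (?D t x v) (?D t x v) \<le> C * exp (- \<kappa> * t) * g x v v"
    if "x \<in> ?M" "v \<in> Es x" "t \<ge> 0" for x v t
    using form_le rates that unfolding sq[symmetric] by blast
  have Eu_rate: "g (T (- t) x) (?D (- t) x v) (?D (- t) x v) \<le> C * exp (- \<kappa> * t) * g x v v"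
    if "x \<in> ?M" "v \<in> Eu x" "t \<ge> 0" for x v t
    using form_le rates that unfolding sq[symmetric] by blast
  have Ef_rate: "g (T t x) (?D t x v) (?D t x v) \<le> C * g x v v"
    if "x \<in> ?M" "v \<in> Ef x" for x v t
    using form_le rates that unfolding C_def by blast
  have decay: "g x v v \<ge> 0 \<Longrightarrow> t \<ge> 0 \<Longrightarrow> C * exp (- \<kappa> * t) * g x v v \<le> C * g x v v" for x v t
    using C by (intro mult_right_mono) (auto simp: mult_le_cancel_left1)
  obtain K1 where K1: "K1 > 0" "\<forall>x\<in>?M. \<forall>v. pullback g L x v v \<le> K1 * g x v v"
    using metrics_comparable[OF g riemannian_metric_pullback[OF g] X] by blast
  obtain K2 where K2: "K2 > 0" "\<forall>x\<in>?M. \<forall>v. pullback g (- L) x v v \<le> K2 * g x v v"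
    using metrics_comparable[OF g riemannian_metric_pullback[OF g] X] by blast
  obtain K3 where K3: "K3 > 0" "\<forall>x\<in>?M. \<forall>v. ?g1 x v v \<le> K3 * g x v v"
    using metrics_comparable[OF g g1 X] by blast
  define K where "K = max K1 (max K2 K3)"
  have K: "K > 0" using K1 by (simp add: K_def)
  have bounds: "pullback g L x v v \<le> K * g x v v" "pullback g (- L) x v v \<le> K * g x v v"
    "?g1 x v v \<le> K * g x v v" if x: "x \<in> ?M" for x v
  proof -
    have le: "K' * g x v v \<le> K * g x v v" if "K' \<in> {K1, K2, K3}" for K'
      using that base.g_nonneg[OF x] by (intro mult_right_mono) (auto simp: K_def)
    show "pullback g L x v v \<le> K * g x v v"
      using order_trans[OF K1(2)[rule_format, OF x, of v] le] by simp
    show "pullback g (- L) x v v \<le> K * g x v v"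
      using order_trans[OF K2(2)[rule_format, OF x, of v] le] by simp
    show "?g1 x v v \<le> K * g x v v"
      using order_trans[OF K3(2)[rule_format, OF x, of v] le] by simp
  qed
  interpret U: hyperbolic_cocycle ?M T ?D g L Es Ef Eu C \<kappa> K
  proof
    fix x t v assume x: "x \<in> ?M"
    show "direct_sum3 (Es x) (Ef x) (Eu x)" using split[OF x] .
    show "?D t x v \<in> Eu (T t x)" if "v \<in> Eu x" using inv(2)[OF x] that by blast
    show "g (T t x) (?D t x v) (?D t x v) \<le> C * g x v v" if "v \<in> Es x" "t \<ge> 0"
      using Es_rate[OF x that] decay[OF base.g_nonneg[OF x] that(2)] by (rule order_trans)
    show "g (T t x) (?D t x v) (?D t x v) \<le> C * g x v v" if "v \<in> Ef x" using Ef_rate[OF x that] .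
  qed (use C K L_large Eu_rate bounds in \<open>simp_all add: pullback_def\<close>)
  note rev = averaged_metric_reverse[of g T ?D L]
  interpret base_rev: metric_cocycle ?M "\<lambda>t. T (- t)" "\<lambda>t. ?D (- t)" g L using base.reverse .
  interpret S: hyperbolic_cocycle ?M "\<lambda>t. T (- t)" "\<lambda>t. ?D (- t)" g L Eu Ef Es C \<kappa> K
  proof
    fix x t v assume x: "x \<in> ?M"
    show "direct_sum3 (Eu x) (Ef x) (Es x)"
      using direct_sum3_swap[OF split[OF x]] .
    show "?D (- t) x v \<in> Es (T (- t) x)" if "v \<in> Es x" using inv(1)[OF x] that by blast
    show "g (T (- t) x) (?D (- t) x v) (?D (- t) x v) \<le> C * g x v v" if "v \<in> Eu x" "t \<ge> 0"
      using Eu_rate[OF x that] decay[OF base.g_nonneg[OF x] that(2)] by (rule order_trans)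
    show "g (T (- t) x) (?D (- t) x v) (?D (- t) x v) \<le> C * g x v v" if "v \<in> Ef x"
      using Ef_rate[OF x that] .
  qed (use C K L_large Es_rate bounds in \<open>simp_all add: pullback_def rev\<close>)
  note S_facts = S.conefield_expanding_cone[OF refl] S.expanding_cone_invariant S.expanding_cone_expands
  show ?thesis
  proof (intro exI conjI ballI allI impI)
    \<comment> \<open>\<open>\<sigma>\<close> is determined by \<open>L\<close> and
      \<open>C\<close>, so both interpretations yield the same rate.\<close>
    show "U.\<sigma> > 0" by (rule U.\<sigma>_pos)
    show "riemannian_metric X A r ?g1" by (rule g1)
    show "uniformly_equivalent_metrics X g ?g1"
      by (rule uniformly_equivalent_metrics_compact[OF g g1 X])
    show "invariant_unstable_conefield X A T Es Ef Eu (expanding_cone T ?D ?g1 U.\<sigma>)"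
      using U.conefield_expanding_cone[OF refl] U.expanding_cone_invariant
      by (simp add: invariant_unstable_conefield_def)
    show "invariant_stable_conefield X A T Es Ef Eu
        (expanding_cone (\<lambda>t. T (- t)) (\<lambda>t. ?D (- t)) ?g1 U.\<sigma>)"
      using S_facts(1,2) by (simp add: invariant_stable_conefield_def rev)
    fix x t v assume "x \<in> ?M" "(0::real) \<le> t"
    then show
      "v \<in> expanding_cone T ?D ?g1 U.\<sigma> x \<Longrightarrow>
        exp (U.\<sigma> * t) * metric_norm ?g1 x v \<le> metric_norm ?g1 (T t x) (?D t x v)"
      "v \<in> expanding_cone (\<lambda>t. T (- t)) (\<lambda>t. ?D (- t)) ?g1 U.\<sigma> x \<Longrightarrow>
        exp (U.\<sigma> * t) * metric_norm ?g1 x v \<le> metric_norm ?g1 (T (- t) x) (?D (- t) x v)"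
      using U.expanding_cone_expands S_facts(3) by (auto simp: rev)
  qed
qed

end
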